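(* Let $\mathbf P$ and $\mathbf Q$ be shift-invariant Borel probability measures on $\mathcal A^{\mathbf N}$, where $\mathcal A$ is a finite set. Suppose that $\mathbf P$ is selectively lower decoupled (SLD) and upper decoupled (UD), that $\mathbf Q$ is upper decoupled (UD), and that the pair $(\mathbf P,\mathbf Q)$ is nondegenerate (ND), i.e. $\overline q(-1)<0$. If, in addition, $\operatorname{supp}\mathbf Q\subseteq\operatorname{supp}\mathbf P$, then $$D_-\overline q(0)\ \le\ \liminf_{N\to\infty}Q_N(y,x)\ \le\ \limsup_{N\to\infty}Q_N(y,x)\ \le\ D_+\overline q(0)$$ for $(\mathbf P\otimes\mathbf Q)$-almost every $(x,y)$, where $Q_N$ is the modified Ziv--Merhav estimator.
   Context: Notation. $\mathcal A$ is a finite set, $\mathbf N=\{1,2,\dots\}$, $\mathcal A^{\mathbf N}$ carries the product ($=$ Borel) $\sigma$-algebra, and $T$ is the left shift. For $x=(x_k)_{k\ge1}$ write $x_i^j=x_ix_{i+1}\cdots x_j$. For $a\in\mathcal A^n$, $[a]=\{x: x_1^n=a\}$ and $\mathbf P[a]=\mathbf P([a])$; for the empty word $\mathbf P[\emptyset]=1$. $\operatorname{supp}\mathbf P_n=\{a\in\mathcal A^n:\mathbf P[a]>0\}$ (for $n=0$, the empty word only) and $\operatorname{supp}\mathbf P=\{x:\mathbf P[x_1^n]>0\text{ for all }n\}$; similarly for $\mathbf Q$. UD: $\mathbf P$ is upper decoupled if there are a nonnegative sequence $(k_n)_{n\ge1}$ with $k_n=o(n)$ and an integer $\tau\ge0$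 such that for all $n,m\in\mathbf N$, $a\in\operatorname{supp}\mathbf P_n$, $\xi\in\operatorname{supp}\mathbf P_\tau$, $b\in\operatorname{supp}\mathbf P_m$: $\mathbf P[a\xi b]\le e^{k_n}\mathbf P[a]\mathbf P[b]$. SLD: $\mathbf P$ is selectively lower decoupled if there are a nonnegative sequence $(k_n)_{n\ge1}$ with $k_n=o(n)$ and an integer $\tau\ge0$ such that for all $n,m\in\mathbf N$, $a\in\operatorname{supp}\mathbf P_n$, $b\in\operatorname{supp}\mathbf P_m$ there exist $0\le\ell\le\tau$ and $\xi\in\operatorname{supp}\mathbf P_\ell$ with $\mathbf P[a\xi b]\ge e^{-k_n}\mathbf P[a]\mathbf P[b]$. Cross-entropic pressure: $q_n(\alpha)=\ln\sum_{a\in\operatorname{supp}\mathbf P_n}\mathbf P[a]^{-\alpha}\,\mathbf Q[a]$ and $\overline q(\alpha)=\limsup_{n\to\infty}\frac1n q_n(\alpha)\in[-\infty,\infty]$ for $\alpha\in\mathbf R$. This is a nondecreasing convex function (possibly improper) with $\overline q(0)=0$. $D_-\overline q(0)=\lim_{\alpha\uparrow0}\overline q(\alpha)/\alpha$ and $D_+\overline q(0)=\lim_{\alpha\downarrow0}\overline q(\alpha)/\alpha$ are its (possibly infinite) left and right derivatives at $0$. Modified Ziv--Merhav (mZM) parsing of $y_1^N$ with respect to $x_1^N$: the first word is the shortest prefix of $y_1^N$ that does not appear as a contiguous substring of $x_1^N$, or all of $y_1^N$ if no such prefix exists (in which case the procedure terminates). Given that the first $i$ words have lengths summing to $L_i<N$,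 the next word is the shortest prefix of $y_{L_i+1}^N$ that does not appear as a contiguous substring of $x_1^N$, or all of $y_{L_i+1}^N$ if no such prefix exists (in which case the procedure terminates). The procedure stops once all of $y_1^N$ is parsed. $c_N=c_N(y|x)$ is the number of words, and $$Q_N(y,x)=\frac{c_N(y|x)\ln N}{N-c_N(y|x)}$$ (understood as $+\infty$ if $c_N=N$). *)

theory Defs
  imports "HOL-Probability.Probability" "HOL-Library.Sublist"
begin

text \<open>
  The alphabet is a finite type \<open>'a\<close>. A sequence indexed by \<open>1, 2, \<dots>\<close> is a stream, so that
  \<open>stake n x\<close> is the word of its first \<open>n\<close> letters and \<open>stl\<close> is the left shift.
  Words are lists. The measurable structure \<open>stream_space (count_space UNIV)\<close> is the product
  sigma-algebra.
\<close>

definition shift_invariant_prob :: "'a::finite stream measure \<Rightarrow> bool" where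
  "shift_invariant_prob M \<longleftrightarrow>
     prob_space M \<and> sets M = sets (stream_space (count_space (UNIV :: 'a set))) \<and>
     distr M M stl = M"

definition cylinder :: "'a list \<Rightarrow> 'a stream set" where
  "cylinder a = {x. stake (length a) x = a}"

definition word_prob :: "'a stream measure \<Rightarrow> 'a list \<Rightarrow> real" where
  "word_prob M a = measure M (cylinder a)"

definition supp_words :: "'a stream measure \<Rightarrow> nat \<Rightarrow> 'a list set" where
  "supp_words M n = {a. length a = n \<and> word_prob M a > 0}"

definition supp :: "'a stream measure \<Rightarrow> 'a stream set" where
  "supp M = {x. \<forall>n. word_prob M (stake n x) > 0}"

definition upper_decoupled :: "'a stream measure \<Rightarrow> bool" where
  "upper_decoupled M \<longleftrightarrow>
     (\<exists>(k :: nat \<Rightarrow> real) (\<tau> :: nat). (\<forall>n. k n \<ge> 0) \<and> k \<in> o(\<lambda>n. real n) \<and>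
        (\<forall>n\<ge>1. \<forall>m\<ge>1. \<forall>a\<in>supp_words M n. \<forall>\<xi>\<in>supp_words M \<tau>. \<forall>b\<in>supp_words M m.
           word_prob M (a @ \<xi> @ b) \<le> exp (k n) * word_prob M a * word_prob M b))"

definition selectively_lower_decoupled :: "'a stream measure \<Rightarrow> bool" where
  "selectively_lower_decoupled M \<longleftrightarrow>
     (\<exists>(k :: nat \<Rightarrow> real) (\<tau> :: nat). (\<forall>n. k n \<ge> 0) \<and> k \<in> o(\<lambda>n. real n) \<and>
        (\<forall>n\<ge>1. \<forall>m\<ge>1. \<forall>a\<in>supp_words M n. \<forall>b\<in>supp_words M m.
           \<exists>l\<le>\<tau>. \<exists>\<xi>\<in>supp_words M l.
             word_prob M (a @ \<xi> @ b) \<ge> exp (- k n) * word_prob M a * word_prob M b))"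

text \<open>The sum below vanishes if no word in the support of \<open>P\<close> is charged by \<open>Q\<close>; then its
  logarithm is \<open>-\<infinity>\<close>, whereas \<open>ln 0 = 0\<close> on the reals.\<close>

definition cross_entropic_sum ::
    "'a stream measure \<Rightarrow> 'a stream measure \<Rightarrow> nat \<Rightarrow> real \<Rightarrow> real" where
  "cross_entropic_sum P Q n \<alpha> =
     (\<Sum>a\<in>supp_words P n. word_prob P a powr (- \<alpha>) * word_prob Q a)"

definition cross_entropic_log ::
    "'a stream measure \<Rightarrow> 'a stream measure \<Rightarrow> nat \<Rightarrow> real \<Rightarrow> ereal" where
  "cross_entropic_log P Q n \<alpha> =
     (if cross_entropic_sum P Q n \<alpha> = 0 then - \<infinity>
      else ereal (ln (cross_entropic_sum P Q n \<alpha>)))"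

definition cross_entropic_pressure ::
    "'a stream measure \<Rightarrow> 'a stream measure \<Rightarrow> real \<Rightarrow> ereal" where
  "cross_entropic_pressure P Q \<alpha> =
     limsup (\<lambda>n. ereal (1 / real n) * cross_entropic_log P Q n \<alpha>)"

definition nondegenerate :: "'a stream measure \<Rightarrow> 'a stream measure \<Rightarrow> bool" where
  "nondegenerate P Q \<longleftrightarrow> cross_entropic_pressure P Q (- 1) < 0"

text \<open>One-sided derivatives at 0. No value at 0 is subtracted because the pressure is 0 there.\<close>

definition left_deriv_0 :: "(real \<Rightarrow> ereal) \<Rightarrow> ereal" where
  "left_deriv_0 q = Lim (at_left 0) (\<lambda>\<alpha>. q \<alpha> / ereal \<alpha>)"

definition right_deriv_0 :: "(real \<Rightarrow> ereal) \<Rightarrow> ereal" where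
  "right_deriv_0 q = Lim (at_right 0) (\<lambda>\<alpha>. q \<alpha> / ereal \<alpha>)"

definition mZM_word :: "'a list \<Rightarrow> 'a list \<Rightarrow> 'a list" where
  "mZM_word x y =
     (if \<exists>k\<le>length y. \<not> sublist (take k y) x
      then take (LEAST k. \<not> sublist (take k y) x) y else y)"

lemma mZM_word_nonempty: "y \<noteq> [] \<Longrightarrow> mZM_word x y \<noteq> []"
proof
  assume y: "y \<noteq> []" and e: "mZM_word x y = []"
  then obtain k where k: "\<not> sublist (take k y) x"
    by (auto simp: mZM_word_def split: if_splits)
  define l where "l = (LEAST k. \<not> sublist (take k y) x)"
  have l: "\<not> sublist (take l y) x" unfolding l_def by (rule LeastI[where P = "\<lambda>k. \<not> sublist (take k y) x", OF k])
  have "take l y = []"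
    using e y by (auto simp: mZM_word_def l_def split: if_splits)
  with l show False by simp
qed

text \<open>Once a word exhausts the remaining part of \<open>y\<close> the recursion stops; this includes the case
  in which every prefix of the remaining part appears in \<open>x\<close>.\<close>

function mZM_parse :: "'a list \<Rightarrow> 'a list \<Rightarrow> 'a list list" where
  "mZM_parse x y =
     (if y = [] then []
      else mZM_word x y # mZM_parse x (drop (length (mZM_word x y)) y))"
  by pat_completeness auto
termination
  by (relation "Wellfounded.measure (\<lambda>(x, y). length y)") (auto simp: mZM_word_nonempty)

declare mZM_parse.simps [simp del]

definition mZM_count :: "nat \<Rightarrow> 'a stream \<Rightarrow> 'a stream \<Rightarrow> nat" where
  "mZM_count N y x = length (mZM_parse (stake N x) (stake N y))"

definition mZM_estimator :: "nat \<Rightarrow> 'a stream \<Rightarrow> 'a stream \<Rightarrow> ereal" where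
  "mZM_estimator N y x =
     (if mZM_count N y x = N then \<infinity>
      else ereal (real (mZM_count N y x) * ln (real N) / (real N - real (mZM_count N y x))))"

end

(* The letters of y are compared with P through the surprisal g(u) = - ln P[u], which is superadditive
   along words up to gaps of length tau and errors o(|u|), by upper decoupling of P. Every mZM word is, up
   to its last letter, a word of x, and is itself (unless it is last) not a word of x. For all but few
   positions of y this forces the surprisal to be at most (1 + eps) ln N, as a word u is expected at most
   N P[u] times in x; selective lower decoupling and nondegeneracy force it to be at least (1 - eps) ln N.

   Lower bound. The Birkhoff sums of the surprisal of windows of fixed length n along y are then at most
   about n c_N ln N. A tiling argument (as in the maximal ergodic theorem) bounds their liminf from below, and
   the pressure at negative arguments makes sure that some n gives a rate close to the left derivative.

   Upper bound. Gaps may fall exactly where the mZM words end, and there the surprisal may jump. Keeping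
   every second mZM word intact and estimating the others by windows gives
   2 g(y_1^N) >= c_N ln N + (window rate) N - o(N). By a Kingman type argument, again by tiling, the window
   rate tends to the rate of g(y_1^N) as n grows, and the latter is at most the right derivative. *)
theory Submission
  imports Defs "HOL-Real_Asymp.Real_Asymp"
begin

section \<open>Words under a shift-invariant measure\<close>

text \<open>Two obstacles shape the argument. \<open>Q\<close> is not assumed ergodic, so rates
  along \<open>y\<close> may depend on \<open>y\<close>. Ergodic statements are therefore
  inequalities between expectations over events closed under the shift, applied to exceptional sets
  that turn out to be null, and rates are only located among countably many levels. Moreover,
  decoupling says something only across a gap of exactly \<tau> letters, and nothing controls how
  much surprisal the letters of a gap carry. Window sums of fixed length n avoid this: cutting a
  word costs them at most a constant depending on n, and averaging over the
  \<open>n + \<tau>\<close> ways of placing separated windows bounds them by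
  \<open>n + \<tau>\<close> times the surprisal. Hence the recurring thresholds
  \<open>real (n + \<tau>) * z + k n\<close>, which stand for the surprisal rate z. In the upper
  bound one of the two copies of the surprisal is cancelled by the window rate, which makes the
  factor 2 harmless.\<close>

definition surprisal :: "'a stream measure \<Rightarrow> 'a list \<Rightarrow> real" where
  "surprisal M a = - ln (word_prob M a)"

lemma word_prob_nonneg [simp]: "0 \<le> word_prob M a"
  by (simp add: word_prob_def)

lemma cylinder_Nil [simp]: "cylinder [] = UNIV"
  by (simp add: cylinder_def)

lemma cylinder_append_iff:
  "x \<in> cylinder (a @ b) \<longleftrightarrow> x \<in> cylinder a \<and> sdrop (length a) x \<in> cylinder b"
  by (simp add: cylinder_def flip: stake_add)

lemma cylinder_append_subset: "cylinder (a @ b) \<subseteq> cylinder a"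
  by (auto simp: cylinder_append_iff)

lemma stake_sdrop_eq_take_drop: "i + j \<le> n \<Longrightarrow> stake j (sdrop i x) = take j (drop i (stake n x))"
  by (simp add: take_stake drop_stake min_absorb1)

lemma sublist_stake_iff:
  "sublist a (stake n x) \<longleftrightarrow> (\<exists>i. i + length a \<le> n \<and> stake (length a) (sdrop i x) = a)"
proof
  assume "sublist a (stake n x)"
  then obtain p s where e: "stake n x = p @ a @ s" by (auto simp: sublist_def)
  have len: "length p + length a + length s = n"
    using arg_cong[OF e, of length] by simp
  have "stake (length a) (sdrop (length p) x) = take (length a) (drop (length p) (stake n x))"
    by (rule stake_sdrop_eq_take_drop) (use len in simp)
  also have "\<dots> = a" using e by simp
  finally show "\<exists>i. i + length a \<le> n \<and> stake (length a) (sdrop i x) = a"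
    using len by (intro exI[of _ "length p"]) simp
next
  assume "\<exists>i. i + length a \<le> n \<and> stake (length a) (sdrop i x) = a"
  then obtain i where i: "i + length a \<le> n" "stake (length a) (sdrop i x) = a" by blast
  have "sublist (take (length a) (drop i (stake n x))) (stake n x)"
    using sublist_take sublist_drop by (rule sublist_order.order.trans)
  then show "sublist a (stake n x)"
    using i(2) stake_sdrop_eq_take_drop[OF i(1), of x] by simp
qed

locale shift_invariant =
  fixes M :: "'a::finite stream measure"
  assumes invariant: "shift_invariant_prob M"
begin

sublocale prob_space M
  using invariant by (simp add: shift_invariant_prob_def)

lemma sets_eq_stream_space: "sets M = sets (stream_space (count_space UNIV))"
  using invariant by (simp add: shift_invariant_prob_def)

lemma space_eq_UNIV [simp]: "space M = UNIV"
  using sets_eq_imp_space_eq[OF sets_eq_stream_space] by (simp add: space_stream_space)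

lemma UNIV_sets [simp]: "UNIV \<in> sets M"
  using sets.top[of M] by simp

lemma measurable_stl_inv [measurable]: "stl \<in> M \<rightarrow>\<^sub>M M"
  by (subst measurable_cong_sets[OF sets_eq_stream_space sets_eq_stream_space]) simp

lemma measurable_sdrop_inv [measurable]: "sdrop n \<in> M \<rightarrow>\<^sub>M M"
  by (subst measurable_cong_sets[OF sets_eq_stream_space sets_eq_stream_space]) simp

lemma measurable_stake_inv [measurable]: "stake n \<in> M \<rightarrow>\<^sub>M count_space UNIV"
  by (subst measurable_cong_sets[OF sets_eq_stream_space refl]) simp

lemma distr_sdrop: "distr M M (sdrop n) = M"
proof (induction n)
  case 0
  have "sdrop 0 = (\<lambda>x. x :: 'a stream)" by (simp add: fun_eq_iff)
  then show ?case by (simp only: distr_id)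
next
  case (Suc n)
  have "distr M M (sdrop (Suc n)) = distr M M (sdrop n \<circ> stl)"
    by (rule arg_cong[where f = "distr M M"]) (auto simp: fun_eq_iff)
  also have "\<dots> = distr (distr M M stl) M (sdrop n)"
    by (subst distr_distr) simp_all
  also have "\<dots> = M"
    using invariant Suc by (simp add: shift_invariant_prob_def)
  finally show ?case .
qed

lemma cylinder_sets [measurable]: "cylinder a \<in> sets M"
proof -
  have "cylinder a = stake (length a) -` {a} \<inter> space M"
    by (auto simp: cylinder_def)
  also have "\<dots> \<in> sets M" by (rule measurable_sets[OF measurable_stake_inv]) simp
  finally show ?thesis .
qed

lemma prob_sdrop: "A \<in> events \<Longrightarrow> prob {x. sdrop n x \<in> A} = prob A"
  using measure_distr[OF measurable_sdrop_inv, of A n]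
  by (simp add: distr_sdrop vimage_def)

lemma integral_sdrop:
  fixes f :: "'a stream \<Rightarrow> real"
  assumes [measurable]: "f \<in> borel_measurable M"
  shows "(\<integral>x. f (sdrop n x) \<partial>M) = (\<integral>x. f x \<partial>M)"
  using integral_distr[OF measurable_sdrop_inv, of f n] by (simp add: distr_sdrop)

lemma word_prob_le_1 [simp]: "word_prob M a \<le> 1"
  by (simp add: word_prob_def)

lemma word_prob_Nil [simp]: "word_prob M [] = 1"
  using prob_space by (simp add: word_prob_def)

lemma word_prob_append_le_left: "word_prob M (a @ b) \<le> word_prob M a"
  unfolding word_prob_def by (intro finite_measure_mono cylinder_append_subset cylinder_sets)

lemma word_prob_append_le_right: "word_prob M (a @ b) \<le> word_prob M b"
proof -
  have "prob (cylinder (a @ b)) \<le> prob {x. sdrop (length a) x \<in> cylinder b}"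
    using measurable_sets[OF measurable_sdrop_inv cylinder_sets, of "length a" b]
    by (intro finite_measure_mono) (auto simp: cylinder_append_iff vimage_def)
  then show ?thesis by (simp add: word_prob_def prob_sdrop)
qed

lemma word_prob_sublist_mono:
  assumes "sublist a b" shows "word_prob M b \<le> word_prob M a"
proof -
  obtain p s where "b = p @ a @ s" using assms by (auto simp: sublist_def)
  then show ?thesis
    using word_prob_append_le_right[of p "a @ s"] word_prob_append_le_left[of a s] by simp
qed

lemma word_prob_pos_sublist: "\<lbrakk>0 < word_prob M b; sublist a b\<rbrakk> \<Longrightarrow> 0 < word_prob M a"
  using word_prob_sublist_mono[of a b] by linarith

lemma surprisal_nonneg [simp]: "0 \<le> surprisal M a"
proof (cases "word_prob M a = 0")
  case False
  then have "0 < word_prob M a" using word_prob_nonneg[of M a] by linarith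
  then show ?thesis by (simp add: surprisal_def)
qed (simp add: surprisal_def)

lemma surprisal_Nil [simp]: "surprisal M [] = 0"
  by (simp add: surprisal_def)

lemma surprisal_sublist_mono:
  "\<lbrakk>0 < word_prob M b; sublist a b\<rbrakk> \<Longrightarrow> surprisal M a \<le> surprisal M b"
  using word_prob_sublist_mono[of a b] word_prob_pos_sublist[of b a]
  by (simp add: surprisal_def)

lemma exp_neg_surprisal: "0 < word_prob M a \<Longrightarrow> exp (- surprisal M a) = word_prob M a"
  by (simp add: surprisal_def)

lemma finite_words: "finite {a::'a list. length a = n}"
  using finite_lists_length_eq[of "UNIV :: 'a set" n] by simp

lemma finite_words_le: "finite {a::'a list. length a \<le> n}"
  using finite_lists_length_le[of "UNIV :: 'a set" n] by simp

text \<open>Words of probability zero do no harm, since \<open>ln 0 = 0\<close> gives them surprisal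
  0. The maximum is thus a finite constant, used for all boundary effects of windows.\<close>

definition max_surprisal :: "nat \<Rightarrow> real" where
  "max_surprisal n = Max (surprisal M ` {a. length a \<le> n})"

lemma surprisal_le_max: "length a \<le> n \<Longrightarrow> surprisal M a \<le> max_surprisal n"
  unfolding max_surprisal_def using finite_words_le[of n] by (intro Max_ge) auto

lemma max_surprisal_nonneg [simp]: "0 \<le> max_surprisal n"
  using surprisal_le_max[of "[]" n] by simp

lemma integrable_stake:
  fixes \<phi> :: "'a list \<Rightarrow> real"
  shows "integrable M (\<lambda>x. \<phi> (stake n x))"
proof (rule integrable_const_bound)
  let ?S = "(\<lambda>a. norm (\<phi> a)) ` {a. length a = n}"
  have "finite ?S" using finite_words by blast
  then show "AE x in M. norm (\<phi> (stake n x)) \<le> Max ?S"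
    by (intro AE_I2 Max_ge) auto
qed simp

lemma expectation_stake:
  fixes \<phi> :: "'a list \<Rightarrow> real"
  shows "(\<integral>x. \<phi> (stake n x) \<partial>M) = (\<Sum>a | length a = n. \<phi> a * word_prob M a)"
proof -
  have "(\<integral>x. \<phi> (stake n x) \<partial>M) = (\<integral>x. (\<Sum>a | length a = n. \<phi> a * indicator (cylinder a) x) \<partial>M)"
  proof (rule Bochner_Integration.integral_cong[OF refl])
    fix x
    have "(\<Sum>a | length a = n. \<phi> a * indicator (cylinder a) x)
        = (\<Sum>a | length a = n. if a = stake n x then \<phi> a else 0)"
      by (rule sum.cong) (auto simp: cylinder_def)
    also have "\<dots> = \<phi> (stake n x)" using finite_words by simp
    finally show "\<phi> (stake n x) = (\<Sum>a | length a = n. \<phi> a * indicator (cylinder a) x)" ..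
  qed
  also have "\<dots> = (\<Sum>a | length a = n. \<phi> a * word_prob M a)"
    by (subst Bochner_Integration.integral_sum)
       (auto simp: word_prob_def intro!: integrable_mult_right integrable_real_indicator
          simp: emeasure_eq_measure)
  finally show ?thesis .
qed

lemma AE_supp: "AE x in M. x \<in> supp M"
proof -
  have "AE x in M. word_prob M (stake n x) > 0" for n
  proof -
    have "AE x in M. \<forall>a\<in>{a. length a = n \<and> word_prob M a = 0}. x \<notin> cylinder a"
    proof (rule AE_finite_allI)
      show "finite {a::'a list. length a = n \<and> word_prob M a = 0}"
        by (rule finite_subset[OF _ finite_words[of n]]) auto
      fix a assume "a \<in> {a. length a = n \<and> word_prob M a = 0}"
      then have "emeasure M (cylinder a) = 0"
        by (simp add: word_prob_def emeasure_eq_measure)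
      then show "AE x in M. x \<notin> cylinder a"
        by (intro AE_I[of _ _ "cylinder a"]) auto
    qed
    then show ?thesis
    proof eventually_elim
      case (elim x)
      then have "word_prob M (stake n x) \<noteq> 0"
        using bspec[OF elim, of "stake n x"] by (auto simp: cylinder_def)
      then show "0 < word_prob M (stake n x)"
        using word_prob_nonneg[of M "stake n x"] by linarith
    qed
  qed
  then show ?thesis by (simp add: supp_def AE_all_countable)
qed

lemma supp_word_prob_pos:
  assumes "x \<in> supp M" shows "0 < word_prob M (stake j (sdrop i x))"
proof (rule word_prob_pos_sublist)
  show "0 < word_prob M (stake (i + j) x)" using assms by (simp add: supp_def)
  show "sublist (stake j (sdrop i x)) (stake (i + j) x)"
    unfolding sublist_stake_iff by (intro exI[of _ i]) simp
qed

lemma supp_sdrop: "x \<in> supp M \<Longrightarrow> sdrop i x \<in> supp M"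
  using supp_word_prob_pos by (auto simp: supp_def)

lemma sets_supp [measurable]: "supp M \<in> sets M"
proof -
  have "supp M = (\<Inter>n. {x \<in> space M. 0 < word_prob M (stake n x)})"
    by (auto simp: supp_def)
  also have "\<dots> \<in> sets M" by measurable
  finally show ?thesis .
qed

end

section \<open>Tiling arguments\<close>

lemma sum_sdrop_add:
  "(\<Sum>t<a + m. f (sdrop t x)) = (\<Sum>t<a. f (sdrop t x)) + (\<Sum>t<m. f (sdrop t (sdrop a x)) :: real)"
  by (induction m) (simp_all add: sdrop_add)

lemma sdrop_invariant: "\<lbrakk>\<And>x. x \<in> C \<Longrightarrow> stl x \<in> C; x \<in> C\<rbrakk> \<Longrightarrow> sdrop n x \<in> C"
  by (induction n arbitrary: x) auto

context shift_invariant
begin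

text \<open>From all points of \<open>C\<close> outside a set of small measure, some block of length
  at most a fixed \<open>m0\<close> gains a rate slightly below z, with gap and error included.
  Blocks are laid greedily along the orbit; a point without a good block is skipped, and invariance
  of the measure bounds the expected number of skips. The error \<open>k\<close> is charged to the
  block just laid, whose length is bounded.\<close>

lemma expectation_superadditive_ge:
  fixes G :: "nat \<Rightarrow> 'a stream \<Rightarrow> real" and k :: "nat \<Rightarrow> real"
  assumes G_int: "\<And>n. integrable M (G n)" and G_nonneg: "\<And>n x. 0 \<le> G n x"
    and C [measurable]: "C \<in> events" and C_stl: "\<And>x. x \<in> C \<Longrightarrow> stl x \<in> C"
    and G_stl: "\<And>n x. x \<in> C \<Longrightarrow> G n (stl x) \<le> G (Suc n) x"
    and super: "\<And>n m x. \<lbrakk>x \<in> C; n \<ge> 1\<rbrakk> \<Longrightarrow>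
      G n x - k n + G m (sdrop (n + \<tau>) x) \<le> G (n + \<tau> + m) x"
    and k: "k \<in> o(\<lambda>n. real n)"
    and freq: "\<And>x. x \<in> C \<Longrightarrow> \<exists>\<^sub>F n in sequentially. z * real n \<le> G n x"
    and "\<eta> > 0"
  shows "\<forall>\<^sub>F L in sequentially. (z * prob C - \<eta>) * real L \<le> (\<integral>x. indicator C x * G L x \<partial>M)"
proof -
  have [measurable]: "G n \<in> borel_measurable M" for n using G_int by auto
  define \<delta> where "\<delta> = \<eta> / 4"
  define w where "w = z - \<delta>"
  have \<delta>: "\<delta> > 0" "\<eta> = 4 * \<delta>" using \<open>\<eta> > 0\<close> by (auto simp: \<delta>_def)
  show ?thesis
  proof (cases "w \<le> 0")
    case True
    have "z * prob C - \<eta> \<le> 0"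
    proof -
      have "z * prob C \<le> \<delta> * prob C" using True by (intro mult_right_mono) (auto simp: w_def)
      also have "\<dots> \<le> \<delta> * 1" using \<delta> by (intro mult_left_mono) auto
      finally show ?thesis using \<delta> by linarith
    qed
    moreover have "0 \<le> (\<integral>x. indicator C x * G L x \<partial>M)" for L
      using G_nonneg by (intro Bochner_Integration.integral_nonneg) auto
    ultimately show ?thesis
      by (intro always_eventually allI) (meson mult_nonpos_nonneg of_nat_0_le_iff order_trans)
  next
    case False
    then have w: "w > 0" by simp
    have "\<forall>\<^sub>F n in sequentially. norm (k n) \<le> \<delta> / 2 * norm (real n)"
      using landau_o.smallD[OF k, of "\<delta> / 2"] \<delta> by simp
    moreover have "\<forall>\<^sub>F n in sequentially. w * real \<tau> \<le> \<delta> / 2 * real n"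
      using \<delta> by real_asymp
    ultimately have small: "\<forall>\<^sub>F n in sequentially. n \<ge> 1 \<and> k n + w * real \<tau> \<le> \<delta> * real n"
      using eventually_ge_at_top[of 1] by eventually_elim auto
    \<comment> \<open>Points with a good block of length at most m. The gap has to be paid for at
      rate \<open>w\<close> as well, so that blocks can be chained.\<close>
    define D where "D m = {x \<in> C. \<exists>n\<in>{1..m}. w * real (n + \<tau>) \<le> G n x - k n}" for m
    have D_meas [measurable]: "D m \<in> events" for m unfolding D_def by measurable
    have D_sub: "D m \<subseteq> C" for m by (auto simp: D_def)
    have "(\<Union>m. D m) = C"
    proof (intro equalityI subsetI)
      fix x assume x: "x \<in> C"
      have "\<exists>\<^sub>F n in sequentially. z * real n \<le> G n x \<and> n \<ge> 1 \<and> k n + w * real \<tau> \<le> \<delta> * real n"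
        using frequently_eventually_frequently[OF freq[OF x] small] by simp
      then obtain n where n: "z * real n \<le> G n x" "n \<ge> 1" "k n + w * real \<tau> \<le> \<delta> * real n"
        using frequently_ex by blast
      then have "w * real (n + \<tau>) \<le> G n x - k n" by (simp add: w_def algebra_simps)
      then have "x \<in> D n" using x n by (auto simp: D_def)
      then show "x \<in> (\<Union>m. D m)" by blast
    qed (use D_sub in auto)
    moreover have "incseq D" by (force simp: incseq_def D_def)
    ultimately have "(\<lambda>m. prob (D m)) \<longlonglongrightarrow> prob C"
      using finite_Lim_measure_incseq[of D] D_meas by (metis image_subsetI)
    then have "\<forall>\<^sub>F m in sequentially. prob C - \<delta> / w < prob (D m)"
      by (rule order_tendstoD) (use \<delta> w in simp)
    then obtain m0 where m0: "prob C - \<delta> / w < prob (D m0)"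
      by (auto simp: eventually_sequentially)
    define E where "E = C - D m0"
    have E_meas [measurable]: "E \<in> events" by (simp add: E_def)
    have "prob E = prob C - prob (D m0)"
      unfolding E_def using D_sub by (intro finite_measure_Diff) auto
    then have "prob E < \<delta> / w" using m0 by linarith
    then have E_small: "w * prob E \<le> \<delta>" using w by (simp add: pos_less_divide_eq mult.commute)
    define cnt where "cnt L x = (\<Sum>t<L. indicator E (sdrop t x) :: real)" for L x
    have cnt_add: "cnt (a + m) x = cnt a x + cnt m (sdrop a x)" for a m x
      unfolding cnt_def by (rule sum_sdrop_add)
    have cnt_nonneg: "0 \<le> cnt L x" for L x unfolding cnt_def by (intro sum_nonneg) auto
    have sdrop_C: "sdrop n x \<in> C" if "x \<in> C" for n x
      using C_stl that by (rule sdrop_invariant)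
    \<comment> \<open>The deduction \<open>m0 + \<tau>\<close> covers a final stretch too short for
      another block with its gap, and \<open>cnt\<close> covers the letters skipped at points of
      \<open>E\<close>.\<close>
    have greedy: "w * (real L - real (m0 + \<tau>) - cnt L x) \<le> G L x" if "x \<in> C" for L x
      using that
    proof (induction L arbitrary: x rule: less_induct)
      case (less L)
      consider "L < m0 + \<tau>" | "L \<ge> m0 + \<tau>" "x \<in> D m0" | "L = 0" | "L > 0" "x \<in> E"
        using less.prems unfolding E_def by force
      then show ?case
      proof cases
        case 1
        then have "real L - real (m0 + \<tau>) - cnt L x \<le> 0" using cnt_nonneg[of L x] by linarith
        then have "w * (real L - real (m0 + \<tau>) - cnt L x) \<le> 0"
          using w by (simp add: mult_le_0_iff)
        then show ?thesis using G_nonneg[of L x] by linarith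
      next
        case 2
        then obtain n where n: "n \<in> {1..m0}" "w * real (n + \<tau>) \<le> G n x - k n"
          by (auto simp: D_def)
        define m where "m = L - (n + \<tau>)"
        have L: "L = n + \<tau> + m" "m < L" using 2 n by (auto simp: m_def)
        have "w * (real L - real (m0 + \<tau>) - cnt L x)
            \<le> w * (real (n + \<tau>) + (real m - real (m0 + \<tau>) - cnt m (sdrop (n + \<tau>) x)))"
          using w cnt_nonneg[of "n + \<tau>" x] by (intro mult_left_mono) (simp_all add: L cnt_add)
        also have "\<dots> = w * real (n + \<tau>) + w * (real m - real (m0 + \<tau>) - cnt m (sdrop (n + \<tau>) x))"
          by (rule distrib_left)
        also have "\<dots> \<le> G n x - k n + G m (sdrop (n + \<tau>) x)"
          using n L less.prems by (intro add_mono less.IH sdrop_C) auto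
        also have "\<dots> \<le> G L x" using super[OF less.prems] n L by simp
        finally show ?thesis .
      next
        case 3
        then have "w * (real L - real (m0 + \<tau>) - cnt L x) \<le> 0"
          using w by (simp add: cnt_def mult_le_0_iff)
        then show ?thesis using G_nonneg[of L x] by linarith
      next
        case 4
        then obtain l where l: "L = Suc l" by (cases L) auto
        have "cnt L x = 1 + cnt l (stl x)"
          using cnt_add[of 1 l x] 4 by (simp add: l cnt_def)
        then have "w * (real L - real (m0 + \<tau>) - cnt L x)
            = w * (real l - real (m0 + \<tau>) - cnt l (stl x))"
          by (simp add: l)
        also have "\<dots> \<le> G l (stl x)" using less.prems by (intro less.IH C_stl) (auto simp: l)
        also have "\<dots> \<le> G L x" using G_stl[OF less.prems] by (simp add: l)
        finally show ?thesis .
      qed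
    qed
    have int_ind: "integrable M (indicator A :: 'a stream \<Rightarrow> real)" if "A \<in> events" for A
      using that by (simp add: emeasure_eq_measure)
    have int_E: "integrable M (\<lambda>x. indicator E (sdrop t x) :: real)" for t
      by (rule integrable_const_bound[where B = 1]) (auto simp: indicator_def)
    have E_sdrop: "(\<integral>x. indicator E (sdrop t x) \<partial>M) = prob E" for t
      using integral_sdrop[of "indicator E" t] by simp
    have main: "w * (real L - real (m0 + \<tau>)) * prob C - w * real L * prob E
        \<le> (\<integral>x. indicator C x * G L x \<partial>M)" for L
    proof -
      have "(\<integral>x. w * (real L - real (m0 + \<tau>)) * indicator C x - w * cnt L x \<partial>M)
          \<le> (\<integral>x. indicator C x * G L x \<partial>M)"
      proof (rule integral_mono)
        show "integrable M (\<lambda>x. w * (real L - real (m0 + \<tau>)) * indicator C x - w * cnt L x)"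
          unfolding cnt_def using int_E int_ind[OF C] by simp
        show "integrable M (\<lambda>x. indicator C x * G L x)"
          using integrable_real_mult_indicator[OF C G_int[of L]] by (simp add: mult.commute)
        fix x
        show "w * (real L - real (m0 + \<tau>)) * indicator C x - w * cnt L x \<le> indicator C x * G L x"
        proof (cases "x \<in> C")
          case True
          then show ?thesis using greedy[OF True, of L] by (simp add: algebra_simps)
        next
          case False
          then show ?thesis using w cnt_nonneg[of L x] by simp
        qed
      qed
      also have "(\<integral>x. w * (real L - real (m0 + \<tau>)) * indicator C x - w * cnt L x \<partial>M)
          = w * (real L - real (m0 + \<tau>)) * prob C - w * (\<Sum>t<L. prob E)"
        unfolding cnt_def using int_E int_ind[OF C] E_sdrop by simp
      finally show ?thesis by simp
    qed
    have "\<forall>\<^sub>F L in sequentially. w * real (m0 + \<tau>) \<le> 2 * \<delta> * real L"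
      using \<delta> by real_asymp
    then show ?thesis
    proof eventually_elim
      case (elim L)
      have "w * real L * prob E \<le> \<delta> * real L"
        using mult_right_mono[OF E_small, of "real L"] by (simp add: ac_simps)
      moreover have "w * real (m0 + \<tau>) * prob C \<le> w * real (m0 + \<tau>) * 1"
        using w by (intro mult_left_mono) auto
      moreover have "\<delta> * real L * prob C \<le> \<delta> * real L * 1"
        using \<delta> by (intro mult_left_mono) auto
      moreover have "w * (real L - real (m0 + \<tau>)) * prob C
          = z * prob C * real L - \<delta> * real L * prob C - w * real (m0 + \<tau>) * prob C"
        by (simp add: w_def algebra_simps)
      moreover have "(z * prob C - \<eta>) * real L = z * prob C * real L - 4 * (\<delta> * real L)"
        by (simp add: \<delta> algebra_simps)
      ultimately show ?case using main[of L] elim by linarith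
    qed
  qed
qed

text \<open>The superadditive bound is applied to the Birkhoff sums of \<open>K - h\<close>, which
  are nonnegative and exactly additive, so that neither gap nor error occurs.\<close>

lemma expectation_le_birkhoff:
  fixes h :: "'a stream \<Rightarrow> real"
  assumes [measurable]: "h \<in> borel_measurable M" and h: "\<And>x. 0 \<le> h x" "\<And>x. h x \<le> K"
    and C [measurable]: "C \<in> events" and C_stl: "\<And>x. x \<in> C \<Longrightarrow> stl x \<in> C"
    and freq: "\<And>x. x \<in> C \<Longrightarrow> \<exists>\<^sub>F n in sequentially. (\<Sum>t<n. h (sdrop t x)) \<le> \<zeta> * real n"
  shows "(\<integral>x. indicator C x * h x \<partial>M) \<le> \<zeta> * prob C"
proof -
  define G where "G n x = (\<Sum>t<n. K - h (sdrop t x))" for n x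
  have G_add: "G (a + m) x = G a x + G m (sdrop a x)" for a m x
    unfolding G_def by (rule sum_sdrop_add)
  have G_nonneg: "0 \<le> G n x" for n x unfolding G_def using h by (intro sum_nonneg) auto
  have int: "integrable M (\<lambda>x. indicator A (f x) * (K - h (sdrop t x)) :: real)"
    if [measurable]: "A \<in> events" "f \<in> M \<rightarrow>\<^sub>M M" for A t f
    using h order.trans[OF h]
    by (intro integrable_const_bound[where B = K] AE_I2) (auto simp: indicator_def)
  have int': "integrable M (\<lambda>x. K - h (sdrop t x) :: real)" for t
    using int[of UNIV "\<lambda>x. x" t] sets.top[of M] by simp
  have ev: "\<forall>\<^sub>F L in sequentially.
      ((K - \<zeta>) * prob C - \<eta>) * real L \<le> (\<integral>x. indicator C x * G L x \<partial>M)" if "\<eta> > 0" for \<eta>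
  proof (rule expectation_superadditive_ge[where k = "\<lambda>_. 0" and \<tau> = 0])
    show "integrable M (G n)" for n
      unfolding G_def[abs_def] using int' by (intro Bochner_Integration.integrable_sum)
    show "G n (stl x) \<le> G (Suc n) x" for n x
      using G_add[of 1 n x] G_nonneg[of 1 x] by simp
    show "\<exists>\<^sub>F n in sequentially. (K - \<zeta>) * real n \<le> G n x" if "x \<in> C" for x
      using freq[OF that] by (rule frequently_elim1) (simp add: G_def sum_subtractf algebra_simps)
  qed (use G_nonneg G_add C_stl that in auto)
  \<comment> \<open>\<open>C\<close> is only closed forward: its points stay in it, but others may
    enter it later. As \<open>K - h\<close> is nonnegative, this still gives the inequality in the
    required direction.\<close>
  have step: "(\<integral>x. indicator C x * G L x \<partial>M) \<le> real L * (\<integral>x. indicator C x * (K - h x) \<partial>M)" for L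
  proof -
    have sdrop_C: "sdrop n x \<in> C" if "x \<in> C" for n x
      using C_stl that by (rule sdrop_invariant)
    have "(\<integral>x. indicator C x * G L x \<partial>M) = (\<Sum>t<L. \<integral>x. indicator C x * (K - h (sdrop t x)) \<partial>M)"
      unfolding G_def sum_distrib_left using int[of C "\<lambda>x. x"]
      by (subst Bochner_Integration.integral_sum) auto
    also have "\<dots> \<le> (\<Sum>t<L. \<integral>x. indicator C (sdrop t x) * (K - h (sdrop t x)) \<partial>M)"
    proof (intro sum_mono integral_mono)
      fix t x
      show "indicator C x * (K - h (sdrop t x)) \<le> indicator C (sdrop t x) * (K - h (sdrop t x))"
        using sdrop_C[of x t] h by (intro mult_right_mono) (auto simp: indicator_def)
    qed (use int[of C] in auto)
    also have "\<dots> = (\<Sum>t<L. \<integral>x. indicator C x * (K - h x) \<partial>M)"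
      by (intro sum.cong refl integral_sdrop[where f = "\<lambda>x. indicator C x * (K - h x)"]) simp
    finally show ?thesis by simp
  qed
  have "(K - \<zeta>) * prob C \<le> (\<integral>x. indicator C x * (K - h x) \<partial>M)"
  proof (rule field_le_epsilon)
    fix \<eta> :: real assume "\<eta> > 0"
    obtain L where L: "((K - \<zeta>) * prob C - \<eta>) * real L \<le> (\<integral>x. indicator C x * G L x \<partial>M)" "L > 0"
      using eventually_happens[OF eventually_conj[OF ev[OF \<open>\<eta> > 0\<close>] eventually_gt_at_top[of 0]]] by auto
    have "real L * ((K - \<zeta>) * prob C - \<eta>) \<le> real L * (\<integral>x. indicator C x * (K - h x) \<partial>M)"
      using L(1) step[of L] by (simp only: mult.commute[of "real L" "_ - _"])
    then have "(K - \<zeta>) * prob C - \<eta> \<le> (\<integral>x. indicator C x * (K - h x) \<partial>M)"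
      using L(2) by (simp only: mult_le_cancel_left_pos of_nat_0_less_iff)
    then show "(K - \<zeta>) * prob C \<le> (\<integral>x. indicator C x * (K - h x) \<partial>M) + \<eta>" by simp
  qed
  also have "(\<integral>x. indicator C x * (K - h x) \<partial>M) = (\<integral>x. K * indicator C x - indicator C x * h x \<partial>M)"
    by (intro Bochner_Integration.integral_cong) (auto simp: algebra_simps)
  also have "\<dots> = K * prob C - (\<integral>x. indicator C x * h x \<partial>M)"
  proof -
    have "integrable M (\<lambda>x. indicator C x * h x)"
      using h order.trans[OF h] by (intro integrable_const_bound[where B = K] AE_I2) (auto simp: indicator_def)
    then show ?thesis by (simp add: emeasure_eq_measure)
  qed
  finally show ?thesis by (simp add: algebra_simps)
qed

end

section \<open>Superadditivity of the surprisal\<close>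

text \<open>Windows that overrun the end of the word are truncated; on streams there is no truncation.\<close>

definition window_sum :: "'a stream measure \<Rightarrow> nat \<Rightarrow> 'a list \<Rightarrow> real" where
  "window_sum M n u = (\<Sum>t<length u. surprisal M (take n (drop t u)))"

definition birkhoff_sum :: "'a stream measure \<Rightarrow> nat \<Rightarrow> nat \<Rightarrow> 'a stream \<Rightarrow> real" where
  "birkhoff_sum M n N y = (\<Sum>t<N. surprisal M (stake n (sdrop t y)))"

lemma window_sum_Nil [simp]: "window_sum M n [] = 0"
  by (simp add: window_sum_def)

lemma window_sum_Cons:
  "window_sum M n (a # u) = surprisal M (take n (a # u)) + window_sum M n u"
  unfolding window_sum_def by (simp only: length_Cons sum.lessThan_Suc_shift drop_0 drop_Suc_Cons)

lemma birkhoff_sum_0 [simp]: "birkhoff_sum M n 0 y = 0"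
  by (simp add: birkhoff_sum_def)

lemma birkhoff_sum_Suc:
  "birkhoff_sum M n (Suc N) y = surprisal M (stake n y) + birkhoff_sum M n N (stl y)"
  unfolding birkhoff_sum_def by (simp only: sum.lessThan_Suc_shift sdrop.simps)

context shift_invariant
begin

lemma window_sum_nonneg [simp]: "0 \<le> window_sum M n u"
  by (simp add: window_sum_def sum_nonneg)

lemma window_sum_le: "window_sum M n u \<le> real (length u) * max_surprisal n"
  unfolding window_sum_def
  using sum_bounded_above[of "{..<length u}" "\<lambda>t. surprisal M (take n (drop t u))" "max_surprisal n"]
  by (simp add: surprisal_le_max)

text \<open>Only windows that start among the last n letters of u reach into v. The induction counts
  them by \<open>min (length u) n\<close>.\<close>

lemma window_sum_append_le:
  "window_sum M n (u @ v) \<le> window_sum M n u + window_sum M n v + real n * max_surprisal n"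
proof -
  let ?K = "max_surprisal n"
  have "window_sum M n (u @ v) \<le> window_sum M n u + window_sum M n v + real (min (length u) n) * ?K"
  proof (induction u)
    case (Cons a u)
    have "surprisal M (take n (a # u @ v)) + real (min (length u) n) * ?K
        \<le> surprisal M (take n (a # u)) + real (min (length (a # u)) n) * ?K"
    proof (cases "length (a # u) \<ge> n")
      case True
      then have "take n (a # u @ v) = take n (a # u)" by (cases n) auto
      moreover have "real (min (length u) n) * ?K \<le> real (min (length (a # u)) n) * ?K"
        by (intro mult_right_mono) auto
      ultimately show ?thesis by simp
    next
      case False
      then have "real (min (length (a # u)) n) * ?K = real (min (length u) n) * ?K + ?K"
        by (simp add: algebra_simps)
      moreover have "surprisal M (take n (a # u @ v)) \<le> ?K" by (rule surprisal_le_max) simp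
      ultimately show ?thesis using surprisal_nonneg[of "take n (a # u)"] by linarith
    qed
    then show ?case using Cons by (simp add: window_sum_Cons)
  qed simp
  also have "real (min (length u) n) * ?K \<le> real n * ?K" by (intro mult_right_mono) auto
  finally show ?thesis by simp
qed

text \<open>The two sums differ only in windows that overrun the finite word, and these start among
  its last n letters.\<close>

lemma birkhoff_sum_le_window_sum:
  "birkhoff_sum M n N y \<le> window_sum M n (stake N y) + real n * max_surprisal n"
proof -
  let ?K = "max_surprisal n"
  have "birkhoff_sum M n N y \<le> window_sum M n (stake N y) + real (min N n) * ?K"
  proof (induction N arbitrary: y)
    case (Suc N)
    have "surprisal M (stake n y) + real (min N n) * ?K
        \<le> surprisal M (take n (stake (Suc N) y)) + real (min (Suc N) n) * ?K"
    proof (cases "Suc N \<ge> n")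
      case True
      then have "take n (stake (Suc N) y) = stake n y" by (simp add: take_stake min_absorb1 del: stake.simps)
      moreover have "real (min N n) * ?K \<le> real (min (Suc N) n) * ?K"
        by (intro mult_right_mono) auto
      ultimately show ?thesis by simp
    next
      case False
      then have "real (min (Suc N) n) * ?K = real (min N n) * ?K + ?K"
        by (simp add: algebra_simps)
      then show ?thesis
        using surprisal_le_max[of "stake n y" n, simplified]
          surprisal_nonneg[of "take n (stake (Suc N) y)"] by linarith
    qed
    then show ?case using Suc[of "stl y"] by (simp add: birkhoff_sum_Suc window_sum_Cons)
  qed simp
  also have "real (min N n) * ?K \<le> real n * ?K" by (intro mult_right_mono) auto
  finally show ?thesis by simp
qed

end

locale decoupled_above = shift_invariant +
  fixes k :: "nat \<Rightarrow> real" and \<tau> :: nat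
  assumes k_nonneg [simp]: "\<And>n. 0 \<le> k n"
    and k_small: "k \<in> o(\<lambda>n. real n)"
    and decoupled: "\<And>n m a \<xi> b. \<lbrakk>1 \<le> n; 1 \<le> m; a \<in> supp_words M n; \<xi> \<in> supp_words M \<tau>; b \<in> supp_words M m\<rbrakk>
      \<Longrightarrow> word_prob M (a @ \<xi> @ b) \<le> exp (k n) * word_prob M a * word_prob M b"
begin

text \<open>Upper decoupling in logarithmic form, with the first \<tau> letters of v as the gap. If
  nothing remains behind the gap, decoupling does not apply and monotonicity takes over.\<close>

lemma surprisal_superadditive:
  assumes pos: "0 < word_prob M (u @ v)" and u: "u \<noteq> []"
  shows "surprisal M u - k (length u) + surprisal M (drop \<tau> v) \<le> surprisal M (u @ v)"
proof (cases "length v \<le> \<tau>")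
  case True
  then have "surprisal M u - k (length u) + surprisal M (drop \<tau> v) \<le> surprisal M u" by simp
  also have "\<dots> \<le> surprisal M (u @ v)" using pos by (rule surprisal_sublist_mono) simp
  finally show ?thesis .
next
  case False
  define \<xi> b where "\<xi> = take \<tau> v" and "b = drop \<tau> v"
  have v: "v = \<xi> @ b" and len: "length \<xi> = \<tau>" "length b \<ge> 1"
    using False by (auto simp: \<xi>_def b_def)
  have pu: "0 < word_prob M u" using pos by (rule word_prob_pos_sublist) simp
  have p\<xi>: "0 < word_prob M \<xi>" using pos by (rule word_prob_pos_sublist) (simp add: v)
  have pb: "0 < word_prob M b"
    using pos by (rule word_prob_pos_sublist) (simp add: v flip: append_assoc)
  have "word_prob M (u @ \<xi> @ b) \<le> exp (k (length u)) * word_prob M u * word_prob M b"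
    by (rule decoupled[of _ "length b"]) (use u len pu p\<xi> pb in \<open>auto simp: supp_words_def Suc_le_eq\<close>)
  then have "ln (word_prob M (u @ v)) \<le> ln (exp (k (length u)) * word_prob M u * word_prob M b)"
    using pos by (simp add: v)
  also have "\<dots> = k (length u) + ln (word_prob M u) + ln (word_prob M b)"
    using pu pb by (simp add: ln_mult)
  finally show ?thesis by (simp add: surprisal_def b_def)
qed

text \<open>Windows whose starting points agree modulo \<open>n + \<tau>\<close> are separated by
  gaps of \<tau> letters, so superadditivity bounds their total by the surprisal of the word.
  Summing over the \<open>n + \<tau>\<close> residues reaches every window.\<close>

lemma window_sum_le_surprisal:
  assumes "0 < word_prob M u" "1 \<le> n"
  shows "window_sum M n u - real (length u) * k n \<le> real (n + \<tau>) * surprisal M u"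
proof -
  have "window_sum M n u - real (length u) * k n \<le> (\<Sum>r<n + \<tau>. surprisal M (drop r u))"
    using assms(1)
  proof (induction u)
    case Nil
    then show ?case by simp
  next
    case (Cons a u)
    let ?w = "a # u"
    have "0 < word_prob M u" using Cons.prems by (rule word_prob_pos_sublist) (simp add: sublist_Cons_right)
    then have IH: "window_sum M n u - real (length u) * k n \<le> (\<Sum>r<n + \<tau>. surprisal M (drop r u))"
      by (rule Cons.IH)
    have "surprisal M (take n ?w) - k n + surprisal M (drop (n + \<tau>) ?w) \<le> surprisal M ?w"
    proof (cases "length ?w < n")
      case False
      have "surprisal M (take n ?w) - k (length (take n ?w)) + surprisal M (drop \<tau> (drop n ?w))
          \<le> surprisal M (take n ?w @ drop n ?w)"
        by (rule surprisal_superadditive) (use Cons.prems assms(2) in auto)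
      moreover have "length (take n ?w) = n" using False by simp
      ultimately show ?thesis
        by (simp only: append_take_drop_id drop_drop add.commute[of \<tau> n])
    qed simp
    \<comment> \<open>Prepending a letter shifts the block of \<open>n + \<tau>\<close> suffixes by
      one: the whole word enters and the suffix behind the first window and its gap leaves.\<close>
    moreover have "(\<Sum>r<n + \<tau>. surprisal M (drop r ?w)) + surprisal M (drop (n + \<tau>) ?w)
        = surprisal M ?w + (\<Sum>r<n + \<tau>. surprisal M (drop r u))"
      using sum.lessThan_Suc_shift[of "\<lambda>r. surprisal M (drop r ?w)" "n + \<tau>"]
        sum.lessThan_Suc[of "\<lambda>r. surprisal M (drop r ?w)" "n + \<tau>"] by simp
    ultimately show ?case using IH by (simp add: window_sum_Cons algebra_simps)
  qed
  also have "\<dots> \<le> (\<Sum>r<n + \<tau>. surprisal M u)"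
    using assms(1) by (intro sum_mono surprisal_sublist_mono) auto
  finally show ?thesis by simp
qed

text \<open>However much surprisal is lost with the outer letters, their windows and those across
  the two cuts cost only \<open>max_surprisal n\<close> each. This allows the outer letters of a
  word to serve as gaps.\<close>

lemma window_sum_le_surprisal_trimmed:
  assumes "0 < word_prob M u" "1 \<le> n"
  shows "window_sum M n u - real (length u) * k n
    \<le> real (n + \<tau>) * surprisal M (take (length u - 2 * \<tau>) (drop \<tau> u))
      + real (2 * n + 2 * \<tau>) * max_surprisal n"
proof -
  let ?K = "max_surprisal n"
  define p m s where "p = take \<tau> u" and "m = take (length u - 2 * \<tau>) (drop \<tau> u)"
    and "s = drop (length u - 2 * \<tau>) (drop \<tau> u)"
  have u: "u = p @ m @ s" unfolding p_def m_def s_def append_take_drop_id ..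
  have len: "length p \<le> \<tau>" "length s \<le> \<tau>" "length m \<le> length u"
    by (auto simp: p_def m_def s_def)
  have "0 < word_prob M m" using assms(1) by (rule word_prob_pos_sublist) (simp add: u)
  then have "window_sum M n m - real (length m) * k n \<le> real (n + \<tau>) * surprisal M m"
    using assms(2) by (rule window_sum_le_surprisal)
  moreover have "real (length m) * k n \<le> real (length u) * k n"
    using len by (intro mult_right_mono) auto
  moreover have "window_sum M n p \<le> real \<tau> * ?K"
    by (rule order.trans[OF window_sum_le mult_right_mono]) (use len in auto)
  moreover have "window_sum M n s \<le> real \<tau> * ?K"
    by (rule order.trans[OF window_sum_le mult_right_mono]) (use len in auto)
  moreover have "window_sum M n u \<le> window_sum M n p + window_sum M n (m @ s) + real n * ?K"
    unfolding u by (rule window_sum_append_le)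
  moreover have "window_sum M n (m @ s) \<le> window_sum M n m + window_sum M n s + real n * ?K"
    by (rule window_sum_append_le)
  ultimately show ?thesis by (simp add: m_def algebra_simps)
qed

end

section \<open>Window sums along typical sequences\<close>

locale cross_pair = P: decoupled_above P k \<tau> + Q: shift_invariant Q
  for P Q :: "'a::finite stream measure" and k :: "nat \<Rightarrow> real" and \<tau> :: nat +
  assumes supp_subset: "supp Q \<subseteq> supp P"
begin

lemma AE_supp: "AE y in Q. y \<in> supp P"
  using Q.AE_supp supp_subset by auto

lemma sets_supp_Q [measurable]: "supp P \<in> sets Q"
  using P.sets_supp by (simp add: P.sets_eq_stream_space Q.sets_eq_stream_space)

lemma word_prob_pos_transfer:
  assumes "0 < word_prob Q a" shows "0 < word_prob P a"
proof -
  have "\<exists>y\<in>cylinder a. y \<in> supp P"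
  proof (rule ccontr)
    assume "\<not> ?thesis"
    then have "AE y in Q. y \<notin> cylinder a" using AE_supp by auto
    then have "Q.prob (cylinder a) = 0"
      by (subst Q.prob_eq_0) auto
    then show False using assms by (simp add: word_prob_def)
  qed
  then obtain y where "y \<in> supp P" "stake (length a) y = a" by (auto simp: cylinder_def)
  then show ?thesis using P.supp_word_prob_pos[of y "length a" 0] by simp
qed

text \<open>The sum is the moment generating function of the surprisal under \<open>Q\<close>: words
  outside the support of \<open>P\<close> have \<open>Q\<close>-mass zero by the inclusion of
  supports.\<close>

lemma cross_entropic_sum_eq_expectation:
  "cross_entropic_sum P Q n \<alpha> = (\<integral>y. exp (\<alpha> * surprisal P (stake n y)) \<partial>Q)"
proof -
  have "(\<integral>y. exp (\<alpha> * surprisal P (stake n y)) \<partial>Q)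
      = (\<Sum>a | length a = n. exp (\<alpha> * surprisal P a) * word_prob Q a)"
    by (rule Q.expectation_stake)
  also have "\<dots> = (\<Sum>a\<in>supp_words P n. exp (\<alpha> * surprisal P a) * word_prob Q a)"
  proof (rule sum.mono_neutral_right)
    show "\<forall>a\<in>{a. length a = n} - supp_words P n. exp (\<alpha> * surprisal P a) * word_prob Q a = 0"
      using word_prob_pos_transfer
      by (auto simp: supp_words_def) (metis order_le_less word_prob_nonneg)
  qed (use Q.finite_words in \<open>auto simp: supp_words_def\<close>)
  also have "\<dots> = (\<Sum>a\<in>supp_words P n. word_prob P a powr (- \<alpha>) * word_prob Q a)"
    by (rule sum.cong) (auto simp: supp_words_def powr_def surprisal_def)
  finally show ?thesis by (simp add: cross_entropic_sum_def)
qed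

text \<open>This excludes the value \<open>- \<infinity>\<close> of
  \<open>cross_entropic_log\<close>, so the pressure is a limsup of real numbers.\<close>

lemma cross_entropic_sum_pos: "0 < cross_entropic_sum P Q n \<alpha>"
proof -
  have int: "integrable Q (\<lambda>y. exp (\<alpha> * surprisal P (stake n y)))"
    by (rule Q.integrable_stake[of "\<lambda>a. exp (\<alpha> * surprisal P a)"])
  have "exp (- \<bar>\<alpha>\<bar> * P.max_surprisal n) = (\<integral>y. exp (- \<bar>\<alpha>\<bar> * P.max_surprisal n) \<partial>Q)"
    using Q.prob_space by simp
  also have "\<dots> \<le> (\<integral>y. exp (\<alpha> * surprisal P (stake n y)) \<partial>Q)"
  proof (intro integral_mono int)
    fix y
    have "\<bar>\<alpha>\<bar> * surprisal P (stake n y) \<le> \<bar>\<alpha>\<bar> * P.max_surprisal n"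
      by (intro mult_left_mono P.surprisal_le_max) auto
    moreover have "- \<bar>\<alpha>\<bar> * surprisal P (stake n y) \<le> \<alpha> * surprisal P (stake n y)"
      by (intro mult_right_mono) auto
    ultimately show "exp (- \<bar>\<alpha>\<bar> * P.max_surprisal n) \<le> exp (\<alpha> * surprisal P (stake n y))" by simp
  qed simp
  finally show ?thesis
    unfolding cross_entropic_sum_eq_expectation by (rule less_le_trans[rotated]) simp
qed

lemma cross_entropic_pressure_eq:
  "cross_entropic_pressure P Q \<alpha>
    = limsup (\<lambda>n. ereal (ln (\<integral>y. exp (\<alpha> * surprisal P (stake n y)) \<partial>Q) / real n))"
proof -
  have "cross_entropic_log P Q n \<alpha> = ereal (ln (cross_entropic_sum P Q n \<alpha>))" for n
    using cross_entropic_sum_pos[of n \<alpha>] by (simp add: cross_entropic_log_def)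
  then show ?thesis
    by (simp add: cross_entropic_pressure_def cross_entropic_sum_eq_expectation)
qed

lemma pressure_lessD:
  assumes "cross_entropic_pressure P Q \<alpha> < ereal r"
  shows "\<forall>\<^sub>F n in sequentially. (\<integral>y. exp (\<alpha> * surprisal P (stake n y)) \<partial>Q) \<le> exp (r * real n)"
proof -
  have "\<forall>\<^sub>F n in sequentially. ereal (ln (cross_entropic_sum P Q n \<alpha>) / real n) < ereal r"
    using assms unfolding cross_entropic_pressure_eq cross_entropic_sum_eq_expectation[symmetric]
    by (rule Limsup_lessD)
  then show ?thesis using eventually_gt_at_top[of 0]
  proof eventually_elim
    case (elim n)
    then have "ln (cross_entropic_sum P Q n \<alpha>) < r * real n" by (simp add: pos_divide_less_eq)
    then have "exp (ln (cross_entropic_sum P Q n \<alpha>)) \<le> exp (r * real n)" by simp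
    then have "cross_entropic_sum P Q n \<alpha> \<le> exp (r * real n)"
      by (simp only: exp_ln[OF cross_entropic_sum_pos])
    then show ?case by (simp only: cross_entropic_sum_eq_expectation)
  qed
qed

text \<open>Unlike the condition that the averages have a lower limit below \<open>\<zeta>\<close>, the unboundedness from below
  of the sums minus \<open>\<zeta> N\<close> passes to the shifted sequence by mere monotonicity.\<close>

definition low_density :: "nat \<Rightarrow> real \<Rightarrow> 'a stream set" where
  "low_density n \<zeta> = {y. \<forall>K::nat. \<exists>\<^sub>F N in sequentially. birkhoff_sum P n N y + real K < \<zeta> * real N}"

lemma birkhoff_sum_measurable [measurable]: "birkhoff_sum P n N \<in> borel_measurable Q"
  unfolding birkhoff_sum_def[abs_def] by measurable

lemma low_density_sets [measurable]: "low_density n \<zeta> \<in> sets Q"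
proof -
  have "low_density n \<zeta> = {y \<in> space Q. \<forall>K::nat. \<forall>N0. \<exists>N\<ge>N0. birkhoff_sum P n N y + real K < \<zeta> * real N}"
    by (simp add: low_density_def frequently_sequentially)
  also have "\<dots> \<in> sets Q" by measurable
  finally show ?thesis .
qed

lemma not_low_densityD:
  assumes "y \<notin> low_density n \<zeta>"
  obtains K where "\<forall>\<^sub>F N in sequentially. \<zeta> * real N - K \<le> birkhoff_sum P n N y"
proof -
  obtain K :: nat where "\<forall>\<^sub>F N in sequentially. \<not> birkhoff_sum P n N y + real K < \<zeta> * real N"
    using assms by (auto simp: low_density_def not_frequently)
  then have "\<forall>\<^sub>F N in sequentially. \<zeta> * real N - real K \<le> birkhoff_sum P n N y"
    by eventually_elim simp
  then show thesis by (rule that)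
qed

text \<open>Dropping the first window cannot raise the sum, and the change by \<zeta> on the other
  side is absorbed by enlarging the arbitrary constant.\<close>

lemma low_density_stl: assumes "y \<in> low_density n \<zeta>" shows "stl y \<in> low_density n \<zeta>"
  unfolding low_density_def frequently_sequentially
proof (intro CollectI allI)
  fix K N0 :: nat
  define K' where "K' = K + nat \<lceil>\<bar>\<zeta>\<bar>\<rceil>"
  have K': "real K + \<zeta> \<le> real K'" unfolding K'_def by linarith
  obtain N where N: "N \<ge> Suc N0" "birkhoff_sum P n N y + real K' < \<zeta> * real N"
    using assms by (auto simp: low_density_def frequently_sequentially)
  then obtain N' where N': "N = Suc N'" by (cases N) auto
  have "birkhoff_sum P n N' (stl y) + real K \<le> birkhoff_sum P n N y + real K' - \<zeta>"
    using K' P.surprisal_nonneg[of "stake n y"] unfolding N' birkhoff_sum_Suc by linarith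
  also have "\<dots> < \<zeta> * real N'" using N(2) by (simp add: N' algebra_simps)
  finally show "\<exists>N\<ge>N0. birkhoff_sum P n N (stl y) + real K < \<zeta> * real N"
    using N N' by auto
qed

lemma expectation_surprisal_le:
  assumes "C \<in> sets Q" "\<And>y. y \<in> C \<Longrightarrow> stl y \<in> C" "C \<subseteq> low_density n \<zeta>"
  shows "(\<integral>y. indicator C y * surprisal P (stake n y) \<partial>Q) \<le> \<zeta> * Q.prob C"
proof (rule Q.expectation_le_birkhoff)
  show "\<exists>\<^sub>F N in sequentially. (\<Sum>t<N. surprisal P (stake n (sdrop t y))) \<le> \<zeta> * real N"
    if "y \<in> C" for y
  proof -
    have "\<exists>\<^sub>F N in sequentially. birkhoff_sum P n N y + real 0 < \<zeta> * real N"
      using that assms(3) unfolding low_density_def by blast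
    then show ?thesis by (rule frequently_elim1) (simp add: birkhoff_sum_def)
  qed
  show "surprisal P (stake n y) \<le> P.max_surprisal n" for y by (rule P.surprisal_le_max) simp
qed (use assms in auto)

text \<open>Jensen's inequality on the event \<open>A n\<close>: the mean surprisal there is at most
  \<open>\<zeta> n\<close>, so the moment generating function is at least
  \<open>exp (- \<beta> * \<zeta> n)\<close> times the probability of \<open>A n\<close>. Since
  \<open>\<zeta> n\<close> grows like n z with z < \<mu>, this probability tends to 0, and points
  lying in all \<open>A n\<close> form a null set.\<close>

lemma AE_not_low_density:
  assumes \<beta>: "\<beta> > 0" and z: "z < \<mu>"
    and mgf: "\<forall>\<^sub>F n in sequentially. (\<integral>y. exp (- \<beta> * surprisal P (stake n y)) \<partial>Q) \<le> exp (- \<beta> * \<mu> * real n)"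
  shows "AE y in Q. \<exists>n\<ge>1. y \<notin> low_density n (real (n + \<tau>) * z + k n)"
proof -
  define \<zeta> where "\<zeta> n = real (n + \<tau>) * z + k n" for n
  define A where "A n = low_density n (\<zeta> n)" for n
  have A_meas [measurable]: "A n \<in> sets Q" for n by (simp add: A_def)
  have bound: "\<forall>\<^sub>F n in sequentially. Q.prob (A n) \<le> exp (\<beta> * \<zeta> n - \<beta> * \<mu> * real n)"
    using mgf
  proof eventually_elim
    case (elim n)
    let ?g = "\<lambda>y. surprisal P (stake n y)"
    have E: "(\<integral>y. indicator (A n) y * ?g y \<partial>Q) \<le> \<zeta> n * Q.prob (A n)"
      by (rule expectation_surprisal_le) (auto simp: A_def low_density_stl)
    have int: "integrable Q (\<lambda>y. indicator (A n) y * ?g y)"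
      using integrable_real_mult_indicator[OF A_meas Q.integrable_stake[of "surprisal P"]]
      by (simp add: mult.commute)
    have int1: "integrable Q (indicator (A n) :: 'a stream \<Rightarrow> real)"
      by (simp add: Q.emeasure_eq_measure)
    \<comment> \<open>The exponential is bounded below by its tangent at \<open>\<zeta> n\<close>.\<close>
    have "exp (- \<beta> * \<zeta> n) * Q.prob (A n)
        \<le> exp (- \<beta> * \<zeta> n) * ((1 + \<beta> * \<zeta> n) * Q.prob (A n) - \<beta> * (\<integral>y. indicator (A n) y * ?g y \<partial>Q))"
      using mult_left_mono[OF E, of \<beta>] \<beta> by (intro mult_left_mono) (auto simp: algebra_simps)
    also have "\<dots> = (\<integral>y. exp (- \<beta> * \<zeta> n) * ((1 + \<beta> * \<zeta> n) * indicator (A n) y - \<beta> * (indicator (A n) y * ?g y)) \<partial>Q)"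
      using int int1 by simp
    also have "\<dots> \<le> (\<integral>y. exp (- \<beta> * ?g y) \<partial>Q)"
    proof (rule integral_mono)
      fix y
      have "exp (- \<beta> * \<zeta> n) * (1 + (\<beta> * \<zeta> n - \<beta> * ?g y)) \<le> exp (- \<beta> * \<zeta> n) * exp (\<beta> * \<zeta> n - \<beta> * ?g y)"
        by (intro mult_left_mono exp_ge_add_one_self) auto
      also have "\<dots> = exp (- \<beta> * ?g y)" by (simp flip: exp_add)
      finally show "exp (- \<beta> * \<zeta> n) * ((1 + \<beta> * \<zeta> n) * indicator (A n) y - \<beta> * (indicator (A n) y * ?g y))
          \<le> exp (- \<beta> * ?g y)"
        by (cases "y \<in> A n") (simp_all add: algebra_simps)
      show "integrable Q (\<lambda>y. exp (- \<beta> * \<zeta> n) * ((1 + \<beta> * \<zeta> n) * indicator (A n) y - \<beta> * (indicator (A n) y * ?g y)))"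
        using int int1 by simp
      show "integrable Q (\<lambda>y. exp (- \<beta> * ?g y))"
        by (rule Q.integrable_stake[of "\<lambda>a. exp (- \<beta> * surprisal P a)"])
    qed
    also note elim
    finally have "exp (- \<beta> * \<zeta> n) * Q.prob (A n) \<le> exp (- \<beta> * \<mu> * real n)" .
    then have "exp (\<beta> * \<zeta> n) * (exp (- \<beta> * \<zeta> n) * Q.prob (A n)) \<le> exp (\<beta> * \<zeta> n) * exp (- \<beta> * \<mu> * real n)"
      by (intro mult_left_mono) auto
    then show ?case by (simp add: mult.assoc[symmetric] flip: exp_add)
  qed
  have "\<forall>\<^sub>F n in sequentially. norm (k n) \<le> (\<mu> - z) / 2 * norm (real n)"
    using landau_o.smallD[OF P.k_small, of "(\<mu> - z) / 2"] z by simp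
  then have "\<forall>\<^sub>F n in sequentially. exp (\<beta> * \<zeta> n - \<beta> * \<mu> * real n)
      \<le> exp (\<beta> * (real \<tau> * z - (\<mu> - z) / 2 * real n))"
  proof eventually_elim
    case (elim n)
    have "\<zeta> n - \<mu> * real n \<le> real \<tau> * z - (\<mu> - z) / 2 * real n"
      using elim P.k_nonneg[of n] by (simp add: \<zeta>_def field_simps)
    from mult_left_mono[OF this, of \<beta>] \<beta> show ?case by (simp add: algebra_simps)
  qed
  with bound have "\<forall>\<^sub>F n in sequentially. Q.prob (A n) \<le> exp (\<beta> * (real \<tau> * z - (\<mu> - z) / 2 * real n))"
    by eventually_elim linarith
  then have bound': "\<forall>\<^sub>F n in sequentially. Q.prob (\<Inter>n\<in>{1..}. A n) \<le> exp (\<beta> * (real \<tau> * z - (\<mu> - z) / 2 * real n))"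
    using eventually_ge_at_top[of 1]
  proof eventually_elim
    case (elim n)
    have "Q.prob (\<Inter>n\<in>{1..}. A n) \<le> Q.prob (A n)" using elim by (intro Q.finite_measure_mono) auto
    with elim show ?case by linarith
  qed
  have "((\<lambda>n. exp (\<beta> * (real \<tau> * z - (\<mu> - z) / 2 * real n))) \<longlongrightarrow> 0) sequentially"
    using \<beta> z by real_asymp
  then have "Q.prob (\<Inter>n\<in>{1..}. A n) \<le> 0"
    using bound' by (rule tendsto_lowerbound) simp
  then have "Q.prob (\<Inter>n\<in>{1..}. A n) = 0" using measure_nonneg[of Q "\<Inter>n\<in>{1..}. A n"] by linarith
  moreover have "(\<Inter>n\<in>{1..}. A n) \<in> sets Q" by (intro sets.countable_INT'') auto
  ultimately have "AE y in Q. y \<notin> (\<Inter>n\<in>{1..}. A n)"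
    using Q.prob_eq_0 by blast
  then show ?thesis by (auto simp: A_def \<zeta>_def)
qed

text \<open>The Kingman type step. On a set of positive measure violating the claim, the expected
  surprisal of the first L letters would be at least about z L times its measure by superadditivity,
  but at most about z' L times its measure, because L is itself an admissible window length with low
  density.\<close>

lemma AE_surprisal_unbounded_imp_not_low_density:
  assumes z: "z' < z"
  shows "AE y in Q. (\<forall>K::nat. \<exists>\<^sub>F N in sequentially. z * real N + real K \<le> surprisal P (stake N y)) \<longrightarrow>
    (\<exists>n\<ge>1. y \<notin> low_density n (real (n + \<tau>) * z' + k n))"
proof -
  define B where "B = {y \<in> supp P. \<forall>K::nat. \<exists>\<^sub>F N in sequentially. z * real N + real K \<le> surprisal P (stake N y)}"
  define \<zeta> where "\<zeta> n = real (n + \<tau>) * z' + k n" for n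
  \<comment> \<open>\<open>B\<close> need not be closed under the shift, hence the condition on the
    whole orbit. Below, it is shown to hold almost everywhere on \<open>B\<close>.\<close>
  define C where "C = {y. \<forall>t. sdrop t y \<in> B} \<inter> (\<Inter>n\<in>{1..}. low_density n (\<zeta> n))"
  have B_meas [measurable]: "B \<in> sets Q"
  proof -
    have "B = {y \<in> space Q. y \<in> supp P \<and> (\<forall>K::nat. \<forall>N0. \<exists>N\<ge>N0. z * real N + real K \<le> surprisal P (stake N y))}"
      by (simp add: B_def frequently_sequentially)
    also have "\<dots> \<in> sets Q" by measurable
    finally show ?thesis .
  qed
  have C_meas [measurable]: "C \<in> sets Q"
  proof -
    have "{y \<in> space Q. \<forall>t. sdrop t y \<in> B} \<in> sets Q" by measurable
    moreover have "(\<Inter>n\<in>{1..}. low_density n (\<zeta> n)) \<in> sets Q" by (intro sets.countable_INT'') auto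
    ultimately show ?thesis by (simp add: C_def sets.Int)
  qed
  have C_stl: "stl y \<in> C" if "y \<in> C" for y
    using that low_density_stl unfolding C_def
    by (auto simp flip: sdrop.simps(2))
  have CB: "y \<in> supp P" "\<exists>\<^sub>F N in sequentially. z * real N \<le> surprisal P (stake N y)" if "y \<in> C" for y
  proof -
    have "y \<in> B" using that by (auto simp: C_def dest!: spec[of _ 0])
    then have "y \<in> supp P" "\<exists>\<^sub>F N in sequentially. z * real N + real 0 \<le> surprisal P (stake N y)"
      unfolding B_def by blast+
    then show "y \<in> supp P" "\<exists>\<^sub>F N in sequentially. z * real N \<le> surprisal P (stake N y)" by simp_all
  qed
  have pos: "0 < word_prob P (stake N y)" if "y \<in> C" for N y
    using CB(1)[OF that] by (simp add: supp_def)
  have C0: "Q.prob C = 0"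
  proof (rule ccontr)
    assume "Q.prob C \<noteq> 0"
    then have C_pos: "Q.prob C > 0" using measure_nonneg[of Q C] by linarith
    \<comment> \<open>With half of the difference given away, the lower rate is (z + z')/2, still
      strictly above the asymptotic upper rate z'.\<close>
    define \<eta> where "\<eta> = (z - z') / 2 * Q.prob C"
    have "\<eta> > 0" using z C_pos by (simp add: \<eta>_def)
    have lower: "\<forall>\<^sub>F L in sequentially. (z * Q.prob C - \<eta>) * real L
        \<le> (\<integral>y. indicator C y * surprisal P (stake L y) \<partial>Q)"
    proof (rule Q.expectation_superadditive_ge[where k = k and \<tau> = \<tau>])
      show "surprisal P (stake n (stl y)) \<le> surprisal P (stake (Suc n) y)" if "y \<in> C" for n y
        by (rule P.surprisal_sublist_mono[OF pos[OF that]]) (simp add: sublist_Cons_right)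
      show "surprisal P (stake n y) - k n + surprisal P (stake m (sdrop (n + \<tau>) y))
          \<le> surprisal P (stake (n + \<tau> + m) y)" if "y \<in> C" "n \<ge> 1" for n m y
      proof -
        have "stake (n + \<tau> + m) y = stake n y @ stake (\<tau> + m) (sdrop n y)"
          by (simp add: stake_add add.assoc)
        moreover have "drop \<tau> (stake (\<tau> + m) (sdrop n y)) = stake m (sdrop (n + \<tau>) y)"
          by (simp add: drop_stake sdrop_add add.commute)
        moreover have "stake n y \<noteq> []" using that(2) by (cases n) auto
        ultimately show ?thesis
          using P.surprisal_superadditive[of "stake n y" "stake (\<tau> + m) (sdrop n y)"]
            pos[OF that(1), of "n + \<tau> + m"] by simp
      qed
    qed (use CB C_stl \<open>\<eta> > 0\<close> P.k_small Q.integrable_stake in auto)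
    have upper: "(\<integral>y. indicator C y * surprisal P (stake L y) \<partial>Q) \<le> \<zeta> L * Q.prob C"
      if "L \<ge> 1" for L
      by (rule expectation_surprisal_le) (use that C_stl in \<open>auto simp: C_def\<close>)
    have "\<forall>\<^sub>F L in sequentially. norm (k L) \<le> (z - z') / 4 * norm (real L)"
      using landau_o.smallD[OF P.k_small, of "(z - z') / 4"] z by simp
    moreover have "\<forall>\<^sub>F L in sequentially. real \<tau> * z' < (z - z') / 4 * real L"
      using z by real_asymp
    ultimately have "\<forall>\<^sub>F L::nat in sequentially. False"
      using lower eventually_ge_at_top[of 1]
    proof eventually_elim
      case (elim L)
      have "((z + z') / 2 * real L) * Q.prob C = (z * Q.prob C - \<eta>) * real L"
        by (simp add: \<eta>_def field_simps)
      also have "\<dots> \<le> \<zeta> L * Q.prob C" using elim upper by force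
      finally have "(z + z') / 2 * real L \<le> \<zeta> L" using C_pos by simp
      then show False using elim P.k_nonneg[of L] by (simp add: \<zeta>_def field_simps)
    qed
    then show False by simp
  qed
  \<comment> \<open>Prepending a letter cannot lower the surprisal, and the arbitrary constant in
    \<open>B\<close> absorbs the change of index.\<close>
  have B_stl: "y \<in> B" if "stl y \<in> B" "y \<in> supp P" for y
    unfolding B_def frequently_sequentially
  proof (intro CollectI conjI allI that(2))
    fix K N0 :: nat
    define K' where "K' = K + nat \<lceil>\<bar>z\<bar>\<rceil>"
    have K': "real K + z \<le> real K'" unfolding K'_def by linarith
    have "\<exists>\<^sub>F N in sequentially. z * real N + real K' \<le> surprisal P (stake N (stl y))"
      using that(1) by (simp add: B_def)
    then have "\<exists>N\<ge>N0. z * real N + real K' \<le> surprisal P (stake N (stl y))"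
      by (simp only: frequently_sequentially)
    then obtain N where N: "N \<ge> N0" "z * real N + real K' \<le> surprisal P (stake N (stl y))"
      by (elim exE conjE)
    have sublist_stl: "sublist (stake N (stl y)) (stake (Suc N) y)" by (simp add: sublist_Cons_right)
    have "z * real (Suc N) + real K \<le> z * real N + real K'" using K' by (simp add: algebra_simps)
    also note N(2)
    also have "surprisal P (stake N (stl y)) \<le> surprisal P (stake (Suc N) y)"
      by (rule P.surprisal_sublist_mono[OF _ sublist_stl]) (use that(2) in \<open>simp only: supp_def mem_Collect_eq\<close>)
    finally show "\<exists>N\<ge>N0. z * real N + real K \<le> surprisal P (stake N y)"
      using N(1) by (intro exI[of _ "Suc N"]) auto
  qed
  have B_sdrop: "y \<in> B" if "sdrop t y \<in> B" "y \<in> supp P" for t y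
    using that
  proof (induction t arbitrary: y)
    case (Suc t)
    have "stl y \<in> supp P" using P.supp_sdrop[OF Suc.prems(2), of 1] by simp
    with Suc have "stl y \<in> B" by simp
    then show ?case using Suc.prems(2) by (rule B_stl)
  qed simp
  \<comment> \<open>Up to a null set the preimage of \<open>B\<close> under the shift lies in
    \<open>B\<close>, and both have the same measure, so they agree almost surely.\<close>
  have "AE y in Q. y \<in> B \<longrightarrow> sdrop t y \<in> B" for t
  proof -
    have S: "{y. sdrop t y \<in> B} \<inter> supp P \<subseteq> B" using B_sdrop by auto
    have m: "{y. sdrop t y \<in> B} \<in> sets Q"
      using measurable_sets[OF Q.measurable_sdrop_inv B_meas, of t] by (simp add: vimage_def)
    have "Q.prob (B - {y. sdrop t y \<in> B}) = Q.prob B - Q.prob (B \<inter> {y. sdrop t y \<in> B})"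
      using m by (subst Q.finite_measure_Diff') auto
    also have "Q.prob (B \<inter> {y. sdrop t y \<in> B}) = Q.prob {y. sdrop t y \<in> B}"
      using m AE_supp B_sdrop by (intro Q.finite_measure_eq_AE) auto
    also have "\<dots> = Q.prob B" by (rule Q.prob_sdrop) simp
    finally have "Q.prob (B - {y. sdrop t y \<in> B}) = 0" by simp
    moreover have "B - {y. sdrop t y \<in> B} \<in> sets Q" using m B_meas by (rule sets.Diff[rotated])
    ultimately have "AE y in Q. y \<notin> B - {y. sdrop t y \<in> B}"
      using Q.prob_eq_0 by blast
    then show ?thesis by eventually_elim simp
  qed
  then have "AE y in Q. \<forall>t. y \<in> B \<longrightarrow> sdrop t y \<in> B" by (subst AE_all_countable) blast
  moreover have "AE y in Q. y \<notin> C" using C0 C_meas Q.prob_eq_0 by blast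
  ultimately show ?thesis using AE_supp
  proof eventually_elim
    case (elim y)
    show ?case
    proof (intro impI)
      assume "\<forall>K::nat. \<exists>\<^sub>F N in sequentially. z * real N + real K \<le> surprisal P (stake N y)"
      then have "y \<in> B" using elim by (simp add: B_def)
      then have "y \<notin> (\<Inter>n\<in>{1..}. low_density n (\<zeta> n))" using elim by (simp add: C_def)
      then show "\<exists>n\<ge>1. y \<notin> low_density n (real (n + \<tau>) * z' + k n)" by (auto simp: \<zeta>_def)
    qed
  qed
qed

text \<open>Markov's inequality for the exponential gives geometrically decaying probabilities, and
  Borel-Cantelli applies.\<close>

lemma AE_surprisal_le:
  assumes \<alpha>: "\<alpha> > 0" and \<mu>: "\<mu> < \<mu>'"
    and mgf: "\<forall>\<^sub>F n in sequentially. (\<integral>y. exp (\<alpha> * surprisal P (stake n y)) \<partial>Q) \<le> exp (\<alpha> * \<mu> * real n)"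
  shows "AE y in Q. \<forall>\<^sub>F N in sequentially. surprisal P (stake N y) \<le> \<mu>' * real N"
proof -
  define E where "E N = {y \<in> space Q. exp (\<alpha> * \<mu>' * real N) \<le> exp (\<alpha> * surprisal P (stake N y))}" for N
  have [measurable]: "E N \<in> sets Q" for N unfolding E_def by measurable
  have "\<forall>\<^sub>F N in sequentially. norm (Q.prob (E N)) \<le> exp (- (\<alpha> * (\<mu>' - \<mu>))) ^ N"
    using mgf
  proof eventually_elim
    case (elim N)
    have "Q.prob (E N) \<le> (\<integral>y. exp (\<alpha> * surprisal P (stake N y)) \<partial>Q) / exp (\<alpha> * \<mu>' * real N)"
      unfolding E_def
      by (intro integral_Markov_inequality_measure[where A = "space Q"]
            Q.integrable_stake[of "\<lambda>a. exp (\<alpha> * surprisal P a)"]) auto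
    also have "\<dots> \<le> exp (\<alpha> * \<mu> * real N) / exp (\<alpha> * \<mu>' * real N)"
      by (intro divide_right_mono elim) auto
    also have "\<dots> = exp (- (\<alpha> * (\<mu>' - \<mu>))) ^ N"
      by (simp add: algebra_simps flip: exp_of_nat_mult exp_diff)
    finally show ?case by simp
  qed
  then have "summable (\<lambda>N. Q.prob (E N))"
    by (rule summable_comparison_test_ev) (use \<alpha> \<mu> in \<open>auto intro!: summable_geometric\<close>)
  then have "AE y in Q. \<forall>\<^sub>F N in sequentially. y \<in> space Q - E N"
    by (intro borel_cantelli_AE1) (auto simp: Q.emeasure_eq_measure)
  then show ?thesis
  proof eventually_elim
    case (elim y)
    then show ?case by eventually_elim (use \<alpha> in \<open>auto simp: E_def\<close>)
  qed
qed

end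

section \<open>Deterministic bounds on the number of mZM words\<close>

lemma mZM_word_eq_take: "mZM_word x y = take (length (mZM_word x y)) y"
  by (auto simp: mZM_word_def min_def)

lemma not_sublist_mZM_word:
  assumes "drop (length (mZM_word x y)) y \<noteq> []"
  shows "\<not> sublist (mZM_word x y) x"
proof (cases "\<exists>k\<le>length y. \<not> sublist (take k y) x")
  case True
  then have "\<not> sublist (take (LEAST k. \<not> sublist (take k y) x) y) x"
    by (metis (mono_tags, lifting) LeastI)
  then show ?thesis using True by (simp add: mZM_word_def)
next
  case False
  then have "mZM_word x y = y" unfolding mZM_word_def by (rule if_not_P)
  then show ?thesis using assms by simp
qed

lemma sublist_butlast_mZM_word: "sublist (butlast (mZM_word x y)) x"
proof (cases "\<exists>k\<le>length y. \<not> sublist (take k y) x")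
  case True
  define l where "l = (LEAST k. \<not> sublist (take k y) x)"
  obtain k where k: "k \<le> length y" "\<not> sublist (take k y) x" using True by blast
  have l: "\<not> sublist (take l y) x" unfolding l_def by (rule LeastI) (rule k)
  have "l \<le> length y" using Least_le[of "\<lambda>k. \<not> sublist (take k y) x" k] k by (simp add: l_def)
  moreover have "l > 0" using l by (cases l) auto
  moreover have "sublist (take (l - 1) y) x"
    using not_less_Least[of "l - 1" "\<lambda>k. \<not> sublist (take k y) x"] \<open>l > 0\<close> by (auto simp: l_def)
  ultimately show ?thesis using True by (simp add: mZM_word_def butlast_take flip: l_def)
next
  case False
  then have "sublist (take (length y) y) x" by blast
  then have "sublist (butlast y) x"
    using sublist_order.order.trans[OF sublist_take[of "length y - 1" y]] by (simp add: butlast_conv_take)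
  then show ?thesis using False unfolding mZM_word_def by (subst if_not_P)
qed

lemma concat_mZM_parse [simp]: "concat (mZM_parse x y) = y"
proof (induction x y rule: mZM_parse.induct)
  case (1 x y)
  then show ?case
    using mZM_word_eq_take[of x y] append_take_drop_id[of "length (mZM_word x y)" y]
    by (subst mZM_parse.simps) auto
qed

lemma mZM_parse_eq_Nil_iff: "mZM_parse x y = [] \<longleftrightarrow> y = []"
  by (subst mZM_parse.simps) simp

text \<open>The last word has to be left out: it may be a remainder of y that occurs in x.\<close>

lemma not_sublist_mZM_parse: "w \<in> set (butlast (mZM_parse x y)) \<Longrightarrow> \<not> sublist w x"
proof (induction x y rule: mZM_parse.induct)
  case (1 x y)
  then show ?case
    using not_sublist_mZM_word[of x y]
    by (subst (asm) (2) mZM_parse.simps) (auto simp: mZM_parse_eq_Nil_iff split: if_splits)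
qed

lemma mZM_parse_word:
  "w \<in> set (mZM_parse x y) \<Longrightarrow> w \<noteq> [] \<and> sublist (butlast w) x"
proof (induction x y rule: mZM_parse.induct)
  case (1 x y)
  then show ?case
    using mZM_word_nonempty[of y x] sublist_butlast_mZM_word[of x y]
    by (subst (asm) (2) mZM_parse.simps) (auto split: if_splits)
qed

lemma length_le_length_concat: "\<lbrakk>\<And>w. w \<in> set ws \<Longrightarrow> w \<noteq> []\<rbrakk> \<Longrightarrow> length ws \<le> length (concat ws)"
proof (induction ws)
  case (Cons w ws)
  then have "length w \<ge> 1" "length ws \<le> length (concat ws)" by (auto simp: Suc_le_eq)
  then show ?case by simp
qed simp

lemma mZM_count_le: "mZM_count N y x \<le> N"
  using length_le_length_concat[of "mZM_parse (stake N x) (stake N y)"] mZM_parse_word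
  by (auto simp: mZM_count_def)

section \<open>Improbable words that nevertheless occur in x\<close>

definition rare_prefix :: "'a stream measure \<Rightarrow> real \<Rightarrow> 'a list \<Rightarrow> 'a list \<Rightarrow> bool" where
  "rare_prefix M \<theta> x u \<longleftrightarrow> (\<exists>l. sublist (take l u) x \<and> word_prob M (take l u) < exp (- \<theta>))"

text \<open>Counting starting points instead of words keeps the quantity monotone in both x and u,
  which later reduces all N to dyadic ones.\<close>

definition rare_count :: "'a stream measure \<Rightarrow> real \<Rightarrow> 'a list \<Rightarrow> 'a list \<Rightarrow> real" where
  "rare_count M \<theta> x u = (\<Sum>t<length u. of_bool (rare_prefix M \<theta> x (drop t u)))"

lemma rare_count_Nil [simp]: "rare_count M \<theta> x [] = 0"
  by (simp add: rare_count_def)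

lemma rare_count_Cons:
  "rare_count M \<theta> x (a # u) = of_bool (rare_prefix M \<theta> x (a # u)) + rare_count M \<theta> x u"
  unfolding rare_count_def by (simp only: length_Cons sum.lessThan_Suc_shift drop_0 drop_Suc_Cons)

lemma rare_count_nonneg [simp]: "0 \<le> rare_count M \<theta> x u"
  by (simp add: rare_count_def sum_nonneg)

lemma rare_prefix_append:
  assumes "rare_prefix M \<theta> x u" shows "rare_prefix M \<theta> x (u @ v)"
proof -
  obtain l where "sublist (take l u) x" "word_prob M (take l u) < exp (- \<theta>)"
    using assms by (auto simp: rare_prefix_def)
  moreover have "take l u = take (min l (length u)) (u @ v)" by (simp add: min_def)
  ultimately show ?thesis unfolding rare_prefix_def by metis
qed

lemma rare_count_append_ge:
  "rare_count M \<theta> x u + rare_count M \<theta> x v \<le> rare_count M \<theta> x (u @ v)"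
proof (induction u)
  case (Cons a u)
  then show ?case using rare_prefix_append[of M \<theta> x "a # u" v]
    by (auto simp: rare_count_Cons of_bool_def)
qed simp

lemma rare_count_mono:
  assumes "sublist x x'" shows "rare_count M \<theta> x u \<le> rare_count M \<theta> x' (u @ v)"
proof -
  have "rare_count M \<theta> x u \<le> rare_count M \<theta> x' u"
    unfolding rare_count_def using assms sublist_order.order.trans
    by (intro sum_mono) (auto simp: rare_prefix_def of_bool_def)
  then show ?thesis
    using rare_count_append_ge[of M \<theta> x' u v] rare_count_nonneg[of M \<theta> x' v] by linarith
qed

context decoupled_above
begin

text \<open>The word u is cut as soon as a piece has surprisal above \<theta>. Such a piece occurs
  in x together with u, so its first position is rare, and there are at most
  \<open>1 + rare_count M \<theta> x u\<close> pieces. Without its last letter a completed piece has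
  surprisal at most \<theta>; the letter and the cut cost
  \<open>(real n + 1) * max_surprisal n\<close>.\<close>

lemma window_sum_le_rare_count:
  assumes "0 < word_prob M u" "sublist u x" "1 \<le> n" "0 \<le> \<theta>"
  shows "window_sum M n u \<le> real (length u) * k n
    + (1 + rare_count M \<theta> x u) * (real (n + \<tau>) * \<theta> + (real n + 1) * max_surprisal n)"
  using assms(1,2)
proof (induction u rule: length_induct)
  case (1 u)
  let ?K = "max_surprisal n" and ?r = "rare_count M \<theta> x"
  let ?C = "real (n + \<tau>) * \<theta> + (real n + 1) * ?K"
  have C: "0 \<le> ?C" using assms(4) by simp
  show ?case
  proof (cases "surprisal M u \<le> \<theta>")
    case True
    have "window_sum M n u \<le> real (length u) * k n + real (n + \<tau>) * surprisal M u"
      using window_sum_le_surprisal[OF "1.prems"(1) assms(3)] by linarith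
    also have "real (n + \<tau>) * surprisal M u \<le> real (n + \<tau>) * \<theta>"
      using True by (intro mult_left_mono) auto
    also have "\<dots> \<le> 1 * ?C" by simp
    also have "\<dots> \<le> (1 + ?r u) * ?C" using C by (intro mult_right_mono) auto
    finally show ?thesis by simp
  next
    case False
    define l where "l = (LEAST l. surprisal M (take l u) > \<theta>)"
    have ex: "surprisal M (take (length u) u) > \<theta>" using False by simp
    have l: "surprisal M (take l u) > \<theta>" unfolding l_def by (rule LeastI) (rule ex)
    have l_le: "l \<le> length u" unfolding l_def by (rule Least_le) (rule ex)
    have "l \<noteq> 0" using l assms(4) by (intro notI) simp
    then obtain j where j: "l = Suc j" by (cases l) auto
    have "surprisal M (take j u) \<le> \<theta>"
      using not_less_Least[of j "\<lambda>l. surprisal M (take l u) > \<theta>"] j by (simp add: l_def)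
    have pos: "0 < word_prob M v" if "sublist v u" for v
      using "1.prems"(1) that by (rule word_prob_pos_sublist)
    obtain a where a: "drop j u = a # drop l u"
      using l_le j by (metis Cons_nth_drop_Suc Suc_le_lessD)
    have "window_sum M n (take j u @ drop j u)
        \<le> window_sum M n (take j u) + window_sum M n (drop j u) + real n * ?K"
      by (rule window_sum_append_le)
    moreover have "window_sum M n (drop j u) \<le> ?K + window_sum M n (drop l u)"
      unfolding a window_sum_Cons by (intro add_right_mono surprisal_le_max) simp
    moreover have "window_sum M n (take j u) \<le> real (length (take j u)) * k n + real (n + \<tau>) * \<theta>"
    proof -
      have "window_sum M n (take j u) - real (length (take j u)) * k n
          \<le> real (n + \<tau>) * surprisal M (take j u)"
        by (intro window_sum_le_surprisal pos assms(3)) simp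
      also have "\<dots> \<le> real (n + \<tau>) * \<theta>"
        using \<open>surprisal M (take j u) \<le> \<theta>\<close> by (intro mult_left_mono) auto
      finally show ?thesis by linarith
    qed
    moreover have "window_sum M n (drop l u) \<le> real (length (drop l u)) * k n + (1 + ?r (drop l u)) * ?C"
    proof -
      have "length (drop l u) < length u" using j l_le by simp
      moreover have "sublist (drop l u) x" using sublist_drop "1.prems"(2) by (rule sublist_order.order.trans)
      ultimately show ?thesis using "1.IH" pos[of "drop l u"] by (metis sublist_drop)
    qed
    moreover have "(real (length (take j u)) + real (length (drop l u))) * k n \<le> real (length u) * k n"
      using j l_le by (intro mult_right_mono) auto
    moreover have "?C + (1 + ?r (drop l u)) * ?C \<le> (1 + ?r u) * ?C"
    proof -
      have "rare_prefix M \<theta> x (take l u)"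
        unfolding rare_prefix_def
      proof (intro exI conjI)
        show "sublist (take l (take l u)) x"
          using sublist_order.order.trans[OF sublist_take "1.prems"(2)] by simp
        have "exp (- surprisal M (take l u)) < exp (- \<theta>)" using l by simp
        then show "word_prob M (take l (take l u)) < exp (- \<theta>)"
          using pos[of "take l u"] by (simp add: exp_neg_surprisal)
      qed
      moreover obtain b v where bv: "take l u = b # v" using j l_le by (cases u) auto
      ultimately have "1 \<le> ?r (take l u)"
        using rare_count_nonneg[of M \<theta> x v] unfolding bv rare_count_Cons by simp
      then have "2 + ?r (drop l u) \<le> 1 + ?r u"
        using rare_count_append_ge[of M \<theta> x "take l u" "drop l u"] by simp
      then have "(2 + ?r (drop l u)) * ?C \<le> (1 + ?r u) * ?C" using C by (rule mult_right_mono)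
      then show ?thesis by (simp add: algebra_simps)
    qed
    ultimately show ?thesis by (simp add: algebra_simps)
  qed
qed

text \<open>The previous bound applies to each \<open>butlast w\<close>. Restoring the last letter
  and joining the words costs a further \<open>(2 * real n + 1) * max_surprisal n\<close> per word,
  which turns n + 1 into 3n + 2.\<close>

lemma window_sum_concat_le:
  assumes "0 < word_prob M (concat ws)" "1 \<le> n" "0 \<le> \<theta>"
    and "\<And>w. w \<in> set ws \<Longrightarrow> w \<noteq> [] \<and> sublist (butlast w) x"
  shows "window_sum M n (concat ws) \<le> real (length (concat ws)) * k n
    + (real (length ws) + rare_count M \<theta> x (concat ws))
      * (real (n + \<tau>) * \<theta> + (3 * real n + 2) * max_surprisal n)"
  using assms(1,4)
proof (induction ws)
  case (Cons w ws)
  let ?K = "max_surprisal n" and ?r = "rare_count M \<theta> x"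
  let ?C = "real (n + \<tau>) * \<theta> + (real n + 1) * ?K" and ?rest = "concat ws"
  let ?D = "real (n + \<tau>) * \<theta> + (3 * real n + 2) * ?K"
  have D: "?D = ?C + (2 * real n + 1) * ?K" by (simp add: algebra_simps)
  have "?D \<ge> 0" using assms(3) by simp
  have w: "w = butlast w @ [last w]" "sublist (butlast w) x" using Cons.prems by auto
  have pos: "0 < word_prob M v" if "sublist v (w @ ?rest)" for v
    using Cons.prems(1) that by (auto intro: word_prob_pos_sublist)
  have "sublist (butlast w) (w @ ?rest)"
    by (metis sublist_append_rightI w(1) append.assoc)
  then have "window_sum M n (butlast w) \<le> real (length (butlast w)) * k n + (1 + ?r (butlast w)) * ?C"
    using w(2) assms(2,3) by (intro window_sum_le_rare_count pos)
  moreover have "real (length (butlast w)) * k n \<le> real (length w) * k n"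
    by (intro mult_right_mono) auto
  moreover have "(1 + ?r (butlast w)) * ?C + (2 * real n + 1) * ?K \<le> (1 + ?r w) * ?D"
  proof -
    have "?r (butlast w) \<le> ?r w"
      using rare_count_append_ge[of M \<theta> x "butlast w" "[last w]"] rare_count_nonneg[of M \<theta> x "[last w]"]
      unfolding w(1)[symmetric] by linarith
    then have "(1 + ?r (butlast w)) * ?C + 1 * ((2 * real n + 1) * ?K)
        \<le> (1 + ?r w) * ?C + (1 + ?r w) * ((2 * real n + 1) * ?K)"
      using assms(3) by (intro add_mono mult_right_mono) auto
    then show ?thesis unfolding D by (simp only: distrib_left mult_1)
  qed
  moreover have "window_sum M n w \<le> window_sum M n (butlast w) + ?K + real n * ?K"
  proof -
    have "window_sum M n [last w] \<le> ?K" using window_sum_le[of n "[last w]"] by simp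
    then show ?thesis using window_sum_append_le[of n "butlast w" "[last w]"] w(1) by simp
  qed
  moreover have "window_sum M n (w @ ?rest) \<le> window_sum M n w + window_sum M n ?rest + real n * ?K"
    by (rule window_sum_append_le)
  moreover have "window_sum M n ?rest \<le> real (length ?rest) * k n + (real (length ws) + ?r ?rest) * ?D"
    by (intro Cons.IH pos) (use Cons.prems in auto)
  moreover have "(1 + ?r w + real (length ws) + ?r ?rest) * ?D \<le> (1 + real (length ws) + ?r (w @ ?rest)) * ?D"
    using rare_count_append_ge[of M \<theta> x w ?rest] \<open>?D \<ge> 0\<close> by (intro mult_right_mono) auto
  ultimately show ?case by (simp add: algebra_simps)
qed simp

end

section \<open>Superadditivity along a parsing, with the gaps in every second word\<close>

fun alternating_sum :: "('b \<Rightarrow> real) \<Rightarrow> ('b \<Rightarrow> real) \<Rightarrow> 'b list \<Rightarrow> real" where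
  "alternating_sum f g [] = 0"
| "alternating_sum f g (w # ws) = f w + alternating_sum g f ws"

lemma alternating_sum_add:
  "alternating_sum f g ws + alternating_sum g f ws = (\<Sum>w\<leftarrow>ws. f w + g w)"
  by (induction ws arbitrary: f g) (simp_all add: algebra_simps)

context decoupled_above
begin

text \<open>Words are alternately kept whole and trimmed by \<open>\<tau>\<close> letters at both ends, so that the gaps
  required by decoupling always fall into the trimmed ones.\<close>

lemma alternating_sum_le:
  assumes "0 < word_prob M (concat ws)" "1 \<le> n"
    and k_le: "\<And>m. k m \<le> \<eta> * real m + K" and "0 \<le> \<eta>"
    and "\<And>w. w \<in> set ws \<Longrightarrow> w \<noteq> []"
    and "\<And>w. w \<in> set (butlast ws) \<Longrightarrow> 2 * \<tau> < length w"
  defines "W \<equiv> \<lambda>w. (window_sum M n w - real (length w) * k n) / real (n + \<tau>)"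
    and "err \<equiv> \<lambda>ws. \<eta> * real (length (concat ws)) + (K + 2 * max_surprisal n) * real (length ws)"
  shows "alternating_sum (surprisal M) W ws - err ws \<le> surprisal M (concat ws)
    \<and> alternating_sum W (surprisal M) ws - err ws \<le> surprisal M (drop \<tau> (concat ws))"
  using assms(1,5,6)
proof (induction ws)
  case Nil
  then show ?case by (simp add: err_def)
next
  case (Cons w ws)
  let ?rest = "concat ws" and ?K = "max_surprisal n"
  have "0 \<le> K" using k_le[of 0] k_nonneg[of 0] by (simp del: k_nonneg)
  have pos: "0 < word_prob M v" if "sublist v (w @ ?rest)" for v
    using Cons.prems(1) that by (auto intro: word_prob_pos_sublist)
  have butlast_ws: "2 * \<tau> < length v" if "v \<in> set (butlast ws)" for v
    using Cons.prems(3)[of v] that by (cases "ws = []") auto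
  have IH: "alternating_sum (surprisal M) W ws - err ws \<le> surprisal M ?rest"
    "alternating_sum W (surprisal M) ws - err ws \<le> surprisal M (drop \<tau> ?rest)"
    using Cons.IH[OF pos[of ?rest] Cons.prems(2) butlast_ws] by auto
  have err: "err (w # ws) = err ws + \<eta> * real (length w) + K + 2 * ?K"
    by (simp add: err_def algebra_simps)
  \<comment> \<open>A word kept whole takes its gap from the first \<tau> letters of the rest. This
    is why the companion inequality concerns the concatenation without these letters.\<close>
  have "surprisal M w - k (length w) + surprisal M (drop \<tau> ?rest) \<le> surprisal M (w @ ?rest)"
    by (rule surprisal_superadditive) (use pos Cons.prems in auto)
  then have "alternating_sum (surprisal M) W (w # ws) - err (w # ws) \<le> surprisal M (concat (w # ws))"
    using IH(2) k_le[of "length w"] max_surprisal_nonneg[of n]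
    unfolding err alternating_sum.simps concat.simps by linarith
  moreover have "alternating_sum W (surprisal M) (w # ws) - err (w # ws)
      \<le> surprisal M (drop \<tau> (concat (w # ws)))"
  proof -
    define m where "m = take (length w - 2 * \<tau>) (drop \<tau> w)"
    have len_m: "length m \<le> length w" by (simp add: m_def)
    have W: "W w \<le> surprisal M m + 2 * ?K"
    proof -
      have "window_sum M n w - real (length w) * k n
          \<le> real (n + \<tau>) * surprisal M m + real (2 * n + 2 * \<tau>) * ?K"
        unfolding m_def by (intro window_sum_le_surprisal_trimmed pos assms(2)) simp
      also have "\<dots> = (surprisal M m + 2 * ?K) * real (n + \<tau>)" by (simp add: algebra_simps)
      finally show ?thesis using assms(2) by (simp add: W_def divide_le_eq)
    qed
    show ?thesis
    \<comment> \<open>Only the last word may be short. It needs no gap behind it, so monotonicity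
      suffices.\<close>
    proof (cases "ws = []")
      case True
      have "surprisal M m \<le> surprisal M (drop \<tau> w)"
        unfolding m_def using pos[of "drop \<tau> w"]
        by (intro surprisal_sublist_mono) (auto simp: sublist_order.order.trans[OF sublist_drop])
      moreover have "0 \<le> \<eta> * real (length w)" using assms(4) by simp
      ultimately show ?thesis using W \<open>0 \<le> K\<close> True by (simp add: err_def)
    next
      case False
      then have "2 * \<tau> < length w" using Cons.prems(3)[of w] by simp
      \<comment> \<open>The last \<tau> letters of the trimmed word, serving as the gap before the
        next word, which is kept whole.\<close>
      define v where "v = drop (length w - 2 * \<tau>) (drop \<tau> w)"
      have split: "drop \<tau> (w @ ?rest) = m @ v @ ?rest"
        using \<open>2 * \<tau> < length w\<close> unfolding m_def v_def
        by (simp only: append_assoc[symmetric] append_take_drop_id) simp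
      have "length v = \<tau>" using \<open>2 * \<tau> < length w\<close> by (simp add: v_def)
      have "m \<noteq> []" using \<open>2 * \<tau> < length w\<close> by (simp add: m_def)
      have "surprisal M m - k (length m) + surprisal M (drop \<tau> (v @ ?rest)) \<le> surprisal M (m @ v @ ?rest)"
        using sublist_drop[of \<tau> "w @ ?rest"] \<open>m \<noteq> []\<close> unfolding split
        by (intro surprisal_superadditive pos)
      moreover have "k (length m) \<le> \<eta> * real (length w) + K"
        using k_le[of "length m"] mult_left_mono[OF _ assms(4), of "real (length m)" "real (length w)"] len_m by simp
      moreover have "drop \<tau> (v @ ?rest) = ?rest" using \<open>length v = \<tau>\<close> by simp
      ultimately show ?thesis
        using W IH(1) unfolding err alternating_sum.simps concat.simps split by simp
    qed
  qed
  ultimately show ?case by simp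
qed

text \<open>Adding the two alternations counts every word once whole and once by its windows, at the
  price of twice the total surprisal. Rejoining the window sums costs one more
  \<open>max_surprisal n\<close> per word, hence the constant 5 instead of 4. The last word is not
  subject to the lower bound \<open>L\<close>.\<close>

lemma sum_surprisal_le:
  assumes "0 < word_prob M (concat ws)" "1 \<le> n"
    and "\<And>m. k m \<le> \<eta> * real m + K" and "0 \<le> \<eta>"
    and "\<And>w. w \<in> set ws \<Longrightarrow> w \<noteq> []"
    and "\<And>w. w \<in> set (butlast ws) \<Longrightarrow> 2 * \<tau> < length w"
    and L: "\<And>w. w \<in> set (butlast ws) \<Longrightarrow> L \<le> surprisal M w"
    and "ws \<noteq> []"
  shows "(real (length ws) - 1) * L
      + (window_sum M n (concat ws) - real (length (concat ws)) * k n) / real (n + \<tau>)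
    \<le> 2 * surprisal M (concat ws) + 2 * \<eta> * real (length (concat ws))
      + (2 * K + 5 * max_surprisal n) * real (length ws)"
proof -
  let ?K = "max_surprisal n"
  define W where "W w = (window_sum M n w - real (length w) * k n) / real (n + \<tau>)" for w
  define E where "E = \<eta> * real (length (concat ws)) + (K + 2 * ?K) * real (length ws)"
  have "alternating_sum (surprisal M) W ws - E \<le> surprisal M (concat ws)"
    "alternating_sum W (surprisal M) ws - E \<le> surprisal M (drop \<tau> (concat ws))"
    using alternating_sum_le[OF assms(1-6)] by (simp_all add: W_def[abs_def] E_def)
  moreover have "surprisal M (drop \<tau> (concat ws)) \<le> surprisal M (concat ws)"
    using assms(1) by (rule surprisal_sublist_mono) simp
  ultimately have "(\<Sum>w\<leftarrow>ws. surprisal M w + W w) \<le> 2 * surprisal M (concat ws) + 2 * E"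
    using alternating_sum_add[of "surprisal M" W ws] by linarith
  moreover have "(\<Sum>w\<leftarrow>ws. surprisal M w + W w) = (\<Sum>w\<leftarrow>ws. surprisal M w) + (\<Sum>w\<leftarrow>ws. W w)"
    by (rule sum_list_addf)
  moreover have "W (concat ws) \<le> (\<Sum>w\<leftarrow>ws. W w) + ?K * real (length ws)"
  proof (induction ws)
    case (Cons w ws)
    have "window_sum M n (w @ concat ws) \<le> window_sum M n w + window_sum M n (concat ws) + real n * ?K"
      by (rule window_sum_append_le)
    moreover have "real n * ?K \<le> real (n + \<tau>) * ?K" by (intro mult_right_mono) auto
    ultimately have "W (w @ concat ws) \<le> (window_sum M n w + window_sum M n (concat ws) + real (n + \<tau>) * ?K
        - real (length w + length (concat ws)) * k n) / real (n + \<tau>)"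
      unfolding W_def by (intro divide_right_mono) auto
    also have "\<dots> = W w + W (concat ws) + real (n + \<tau>) * ?K / real (n + \<tau>)"
      by (simp only: W_def add_divide_distrib diff_divide_distrib distrib_right of_nat_add)
    also have "real (n + \<tau>) * ?K / real (n + \<tau>) = ?K"
      using assms(2) by (intro nonzero_mult_div_cancel_left) simp
    finally show ?case using Cons by (simp add: algebra_simps)
  qed (simp add: W_def)
  moreover have "(real (length ws) - 1) * L \<le> (\<Sum>w\<leftarrow>ws. surprisal M w)"
  proof -
    have ws: "ws = butlast ws @ [last ws]" using assms(8) by simp
    have "(\<Sum>w\<leftarrow>butlast ws. L) \<le> (\<Sum>w\<leftarrow>butlast ws. surprisal M w)"
      using L by (rule sum_list_mono)
    moreover have "(\<Sum>w\<leftarrow>butlast ws. surprisal M w) \<le> (\<Sum>w\<leftarrow>butlast ws @ [last ws]. surprisal M w)"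
      by simp
    ultimately have "real (length (butlast ws)) * L \<le> (\<Sum>w\<leftarrow>ws. surprisal M w)"
      unfolding ws[symmetric] by (simp add: sum_list_triv)
    then show ?thesis using assms(8) by (simp add: of_nat_diff Suc_le_eq)
  qed
  ultimately show ?thesis by (simp add: W_def E_def algebra_simps)
qed

end

section \<open>Occurrence probabilities\<close>

context shift_invariant
begin

lemma stake_pred_sets [measurable]: "{x. R (stake n x)} \<in> sets M"
proof -
  have "{x \<in> space M. R (stake n x)} \<in> sets M" by measurable
  then show ?thesis by simp
qed

lemma sdrop_cylinder_sets [measurable]: "{x. sdrop n x \<in> cylinder a} \<in> sets M"
  using measurable_sets[OF measurable_sdrop_inv cylinder_sets, of n a] by (simp add: vimage_def)

lemma prob_stake: "prob {x. R (stake n x)} = (\<Sum>a | length a = n \<and> R a. word_prob M a)"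
proof -
  have "prob {x. R (stake n x)} = (\<integral>x. indicator {x. R (stake n x)} x \<partial>M)" by simp
  also have "\<dots> = (\<integral>x. of_bool (R (stake n x)) \<partial>M)"
    by (rule Bochner_Integration.integral_cong) (auto simp: indicator_def)
  also have "\<dots> = (\<Sum>a | length a = n. of_bool (R a) * word_prob M a)"
    by (rule expectation_stake)
  also have "\<dots> = (\<Sum>a | length a = n \<and> R a. word_prob M a)"
    by (rule sum.mono_neutral_cong_right) (use finite_words in auto)
  finally show ?thesis .
qed

lemma prob_sublist_le:
  assumes "a \<noteq> []"
  shows "prob {x. sublist a (stake N x)} \<le> real N * word_prob M a"
proof -
  have "{x. sublist a (stake N x)} \<subseteq> (\<Union>i<N. {x. sdrop i x \<in> cylinder a})"
    using assms by (fastforce simp: sublist_stake_iff cylinder_def neq_Nil_conv)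
  then have "prob {x. sublist a (stake N x)} \<le> prob (\<Union>i<N. {x. sdrop i x \<in> cylinder a})"
    by (intro finite_measure_mono) auto
  also have "\<dots> \<le> (\<Sum>i<N. prob {x. sdrop i x \<in> cylinder a})"
    by (intro finite_measure_subadditive_finite) auto
  also have "\<dots> = real N * word_prob M a" by (simp add: prob_sdrop word_prob_def)
  finally show ?thesis .
qed

end

section \<open>Probability that a word fails to occur\<close>

locale selectively_decoupled_below = shift_invariant M
  for M :: "'a::finite stream measure" +
  fixes \<kappa> :: "nat \<Rightarrow> real" and \<sigma> :: nat
  assumes \<kappa>_nonneg: "\<And>n. 0 \<le> \<kappa> n"
    and \<kappa>_small: "\<kappa> \<in> o(\<lambda>n. real n)"
    and connecting_word: "\<And>n m a b. \<lbrakk>1 \<le> n; 1 \<le> m; a \<in> supp_words M n; b \<in> supp_words M m\<rbrakk>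
      \<Longrightarrow> \<exists>l\<le>\<sigma>. \<exists>\<xi>\<in>supp_words M l. exp (- \<kappa> n) * word_prob M a * word_prob M b \<le> word_prob M (a @ \<xi> @ b)"
begin

text \<open>The connecting word is used with \<open>a\<close> in front of a word avoiding \<open>a\<close>, since the loss \<open>\<kappa>\<close> only
  depends on the length of the first of the two words.\<close>

lemma prob_not_sublist_step:
  fixes a :: "'a list"
  assumes a: "a \<noteq> []" "0 < word_prob M a" and "1 \<le> m"
  defines "\<delta> \<equiv> exp (- \<kappa> (length a)) * word_prob M a"
  shows "prob {x. \<not> sublist a (stake (length a + \<sigma> + m) x)} \<le> (1 - \<delta>) * prob {x. \<not> sublist a (stake m x)}"
proof -
  define n where "n = length a"
  define A where "A = {x. \<not> sublist a (stake (n + \<sigma> + m) x)}"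
  define U where "U = {u. length u = m \<and> \<not> sublist a u}"
  define E where "E u = {x. sdrop (n + \<sigma>) x \<in> cylinder u}" for u :: "'a list"
  have [measurable]: "A \<in> sets M" "E u \<in> sets M" for u by (simp_all add: A_def E_def stake_pred_sets sdrop_cylinder_sets)
  have fin: "finite U" by (rule finite_subset[OF _ finite_words[of m]]) (auto simp: U_def)
  have prob_E: "prob (E u) = word_prob M u" for u
    by (simp add: E_def prob_sdrop word_prob_def)
  have part: "prob (A \<inter> E u) \<le> (1 - \<delta>) * word_prob M u" if uU: "u \<in> U" for u
  proof (cases "word_prob M u = 0")
    case True
    have "prob (A \<inter> E u) \<le> prob (E u)" by (intro finite_measure_mono) auto
    then show ?thesis using True by (simp add: prob_E)
  next
    case False
    then have u: "0 < word_prob M u" using word_prob_nonneg[of M u] by linarith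
    have "length a \<ge> 1" using a(1) by (simp add: Suc_le_eq)
    then obtain l \<xi> where \<xi>: "l \<le> \<sigma>" "length \<xi> = l"
        "exp (- \<kappa> n) * word_prob M a * word_prob M u \<le> word_prob M (a @ \<xi> @ u)"
    proof -
      have "a \<in> supp_words M n" "u \<in> supp_words M m"
        using a(2) u uU by (simp_all add: supp_words_def U_def n_def)
      with connecting_word[of n m a u] \<open>length a \<ge> 1\<close> assms(3) show thesis
        by (auto simp: supp_words_def n_def intro: that)
    qed
    \<comment> \<open>Starting at \<open>\<sigma> - l\<close> puts u at position
      \<open>n + \<sigma>\<close> whatever the length l of the connecting word, so that
      \<open>H\<close> is contained in \<open>E u\<close>.\<close>
    define H where "H = {x. sdrop (\<sigma> - l) x \<in> cylinder (a @ \<xi> @ u)}"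
    have [measurable]: "H \<in> sets M" by (simp add: H_def sdrop_cylinder_sets)
    have "H \<subseteq> E u"
      using \<xi> by (auto simp: H_def E_def cylinder_append_iff sdrop_add n_def algebra_simps)
    have "x \<notin> A" if "x \<in> H" for x
    proof -
      have "stake (length a) (sdrop (\<sigma> - l) x) = a"
        using that by (simp add: H_def cylinder_append_iff) (simp add: cylinder_def)
      then have "sublist a (stake (n + \<sigma> + m) x)"
        unfolding sublist_stake_iff by (intro exI[of _ "\<sigma> - l"]) (simp add: n_def)
      then show ?thesis by (simp add: A_def)
    qed
    then have "A \<inter> E u \<subseteq> E u - H" by blast
    then have "prob (A \<inter> E u) \<le> prob (E u - H)" by (intro finite_measure_mono) auto
    also have "\<dots> = prob (E u) - prob H"
      using \<open>H \<subseteq> E u\<close> by (intro finite_measure_Diff) auto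
    also have "prob H = word_prob M (a @ \<xi> @ u)"
      unfolding H_def by (simp add: prob_sdrop word_prob_def)
    finally show ?thesis using \<xi>(3) by (simp add: prob_E \<delta>_def n_def algebra_simps)
  qed
  have "A \<subseteq> (\<Union>u\<in>U. A \<inter> E u)"
  proof
    fix x assume x: "x \<in> A"
    define u where "u = stake m (sdrop (n + \<sigma>) x)"
    have "u = drop (n + \<sigma>) (stake (n + \<sigma> + m) x)"
      by (simp add: u_def drop_stake)
    then have "sublist u (stake (n + \<sigma> + m) x)" by (simp only: sublist_drop)
    then have "\<not> sublist a u" using x sublist_order.order.trans by (auto simp: A_def)
    then have "u \<in> U" "x \<in> E u" by (simp_all add: U_def E_def u_def cylinder_def)
    then show "x \<in> (\<Union>u\<in>U. A \<inter> E u)" using x by blast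
  qed
  then have "prob A \<le> prob (\<Union>u\<in>U. A \<inter> E u)"
    using fin by (intro finite_measure_mono) auto
  also have "\<dots> \<le> (\<Sum>u\<in>U. prob (A \<inter> E u))"
    using fin by (intro finite_measure_subadditive_finite) auto
  also have "\<dots> \<le> (\<Sum>u\<in>U. (1 - \<delta>) * word_prob M u)"
    by (intro sum_mono part)
  also have "\<dots> = (1 - \<delta>) * prob {x. \<not> sublist a (stake m x)}"
    by (simp add: U_def prob_stake[where R = "\<lambda>u. \<not> sublist a u"] sum_distrib_left)
  finally show ?thesis by (simp add: A_def n_def)
qed

text \<open>Each further block of \<open>length a + \<sigma>\<close> letters multiplies the
  probability by at most \<open>1 - \<delta>\<close>. The iteration starts at length 1 because the
  step needs a nonempty remainder.\<close>

lemma prob_not_sublist_le: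
  fixes a :: "'a list"
  assumes a: "a \<noteq> []" "0 < word_prob M a"
  defines "\<delta> \<equiv> exp (- \<kappa> (length a)) * word_prob M a"
  shows "prob {x. \<not> sublist a (stake N x)} \<le> exp (2 - \<delta> * real N / real (length a + \<sigma>))"
proof -
  define d where "d = length a + \<sigma>"
  have d: "d > 0" using a by (simp add: d_def)
  have \<delta>: "0 \<le> \<delta>" "\<delta> \<le> 1"
    using mult_mono[of "exp (- \<kappa> (length a))" 1 "word_prob M a" 1] \<kappa>_nonneg[of "length a"]
    by (auto simp: \<delta>_def)
  have step: "prob {x. \<not> sublist a (stake (1 + j * d) x)} \<le> (1 - \<delta>) ^ j" for j
  proof (induction j)
    case (Suc j)
    have "prob {x. \<not> sublist a (stake (length a + \<sigma> + (1 + j * d)) x)}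
        \<le> (1 - \<delta>) * prob {x. \<not> sublist a (stake (1 + j * d) x)}"
      unfolding \<delta>_def by (rule prob_not_sublist_step[OF a]) simp
    also have "\<dots> \<le> (1 - \<delta>) * (1 - \<delta>) ^ j" using Suc \<delta> by (intro mult_left_mono) auto
    finally show ?case by (simp add: d_def algebra_simps)
  qed simp
  show ?thesis
  proof (cases "N = 0")
    case True
    have "prob {x. \<not> sublist a (stake N x)} \<le> 1" by simp
    also have "(1::real) \<le> exp 2" by simp
    finally show ?thesis using True by simp
  next
    case False
    define j where "j = (N - 1) div d"
    have "N - 1 < d * Suc j" using d dividend_less_times_div[of d "N - 1"] by (simp add: j_def)
    then have "N \<le> d * Suc j" using False by linarith
    then have "real N \<le> real d * (real j + 1)" by (metis of_nat_le_iff of_nat_mult of_nat_Suc add.commute)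
    then have "real N / real d \<le> real j + 1" using d by (simp add: divide_le_eq mult.commute)
    then have "\<delta> * (real N / real d) \<le> \<delta> * (real j + 1)" using \<delta> by (intro mult_left_mono) auto
    \<comment> \<open>Rounding down to whole blocks costs at most \<delta>, which is at most 1; the
      2 in the exponent leaves room for it.\<close>
    then have j: "- (\<delta> * real j) \<le> 2 - \<delta> * real N / real d" using \<delta> by (simp add: algebra_simps)
    have "1 + j * d \<le> N" using False by (simp add: j_def div_times_less_eq_dividend Suc_le_eq)
      (metis One_nat_def Suc_pred div_times_less_eq_dividend le_imp_less_Suc neq0_conv)
    then have "sublist (stake (1 + j * d) x) (stake N x)" for x :: "'a stream"
      by (metis sublist_take take_stake min_def)
    then have "{x. \<not> sublist a (stake N x)} \<subseteq> {x. \<not> sublist a (stake (1 + j * d) x)}"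
      using sublist_order.order.trans by blast
    then have "prob {x. \<not> sublist a (stake N x)} \<le> prob {x. \<not> sublist a (stake (1 + j * d) x)}"
      by (intro finite_measure_mono stake_pred_sets)
    also note step
    also have "(1 - \<delta>) ^ j \<le> exp (- \<delta>) ^ j"
      using \<delta> exp_ge_add_one_self[of "- \<delta>"] by (intro power_mono) auto
    also have "\<dots> = exp (- (\<delta> * real j))" by (simp add: mult.commute flip: exp_of_nat_mult)
    also have "\<dots> \<le> exp (2 - \<delta> * real N / real d)" using j by simp
    finally show ?thesis by (simp add: d_def)
  qed
qed

end

section \<open>Almost sure occurrence of words\<close>

context cross_pair
begin

sublocale PQ: pair_prob_space P Q ..

lemma stake_pair_sets:
  "{w. R (stake m (fst w)) (stake n (snd w))} \<in> sets (P \<Otimes>\<^sub>M Q)"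
proof -
  have "(\<lambda>w. (stake m (fst w), stake n (snd w))) \<in> P \<Otimes>\<^sub>M Q \<rightarrow>\<^sub>M
      (count_space UNIV \<Otimes>\<^sub>M count_space UNIV :: ('a list \<times> 'a list) measure)"
    by measurable
  then have "(\<lambda>w. (stake m (fst w), stake n (snd w))) \<in> P \<Otimes>\<^sub>M Q \<rightarrow>\<^sub>M
      (count_space UNIV :: ('a list \<times> 'a list) measure)"
    by (simp add: pair_measure_countable)
  from measurable_sets[OF this, of "{(a, b). R a b}"] show ?thesis
    by (simp add: vimage_def space_pair_measure)
qed

lemma AE_snd: "AE y in Q. R y \<Longrightarrow> AE w in P \<Otimes>\<^sub>M Q. R (snd w)"
proof -
  assume "AE y in Q. R y"
  then obtain N where N: "{y \<in> space Q. \<not> R y} \<subseteq> N" "emeasure Q N = 0" "N \<in> sets Q"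
    by (rule AE_E)
  show ?thesis
  proof (rule AE_I)
    show "{w \<in> space (P \<Otimes>\<^sub>M Q). \<not> R (snd w)} \<subseteq> space P \<times> N" using N by auto
    show "emeasure (P \<Otimes>\<^sub>M Q) (space P \<times> N) = 0"
      using N by (subst Q.emeasure_pair_measure_Times) auto
    show "space P \<times> N \<in> sets (P \<Otimes>\<^sub>M Q)" using N by auto
  qed
qed

text \<open>With y frozen the bound is uniform, so by Fubini it holds under the product measure,
  where Borel-Cantelli applies.\<close>

lemma AE_eventually_not_stake:
  assumes bound: "\<And>j y. P.prob {x. R j (stake (m j) x) (stake (n j) y)} \<le> b j" and "summable b"
  shows "AE w in P \<Otimes>\<^sub>M Q. \<forall>\<^sub>F j in sequentially. \<not> R j (stake (m j) (fst w)) (stake (n j) (snd w))"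
proof -
  define E where "E j = {w. R j (stake (m j) (fst w)) (stake (n j) (snd w))}" for j
  have E_meas [measurable]: "E j \<in> sets (P \<Otimes>\<^sub>M Q)" for j
    unfolding E_def by (rule stake_pair_sets)
  have b: "0 \<le> b j" for j using order.trans[OF measure_nonneg bound] .
  have "measure (P \<Otimes>\<^sub>M Q) (E j) \<le> b j" for j
  proof -
    have "emeasure (P \<Otimes>\<^sub>M Q) (E j) = (\<integral>\<^sup>+y. emeasure P ((\<lambda>x. (x, y)) -` E j) \<partial>Q)"
      by (rule PQ.emeasure_pair_measure_alt2) simp
    also have "\<dots> \<le> (\<integral>\<^sup>+y. ennreal (b j) \<partial>Q)"
    proof (rule nn_integral_mono)
      fix y
      have "(\<lambda>x. (x, y)) -` E j = {x. R j (stake (m j) x) (stake (n j) y)}"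
        by (auto simp: E_def)
      then show "emeasure P ((\<lambda>x. (x, y)) -` E j) \<le> ennreal (b j)"
        using bound[of j y] by (simp add: P.emeasure_eq_measure b)
    qed
    also have "\<dots> = ennreal (b j)" by (simp add: Q.emeasure_space_1[unfolded Q.space_eq_UNIV])
    finally show ?thesis by (simp add: PQ.emeasure_eq_measure b)
  qed
  then have "summable (\<lambda>j. measure (P \<Otimes>\<^sub>M Q) (E j))"
    by (intro summable_comparison_test'[OF \<open>summable b\<close>]) simp
  then have "AE w in P \<Otimes>\<^sub>M Q. \<forall>\<^sub>F j in sequentially. w \<in> space (P \<Otimes>\<^sub>M Q) - E j"
    by (intro borel_cantelli_AE1) (auto simp: PQ.emeasure_eq_measure)
  then show ?thesis
    by eventually_elim (auto simp: E_def elim: eventually_mono)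
qed

text \<open>If some rare prefix of u occurs in x, then so does the shortest one. A single word thus
  has to be bounded, without a union over lengths; it is nonempty because the empty word has
  probability 1.\<close>

lemma prob_rare_prefix_le:
  assumes "0 \<le> \<theta>"
  shows "P.prob {x. rare_prefix P \<theta> (stake N x) u} \<le> real N * exp (- \<theta>)"
proof (cases "\<exists>l. word_prob P (take l u) < exp (- \<theta>)")
  case False
  then show ?thesis by (auto simp: rare_prefix_def)
next
  case True
  define l where "l = (LEAST l. word_prob P (take l u) < exp (- \<theta>))"
  have l: "word_prob P (take l u) < exp (- \<theta>)" unfolding l_def using True by (rule LeastI_ex)
  have "take l u \<noteq> []"
  proof
    assume "take l u = []"
    with l assms show False by simp
  qed
  have "{x. rare_prefix P \<theta> (stake N x) u} \<subseteq> {x. sublist (take l u) (stake N x)}"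
  proof clarify
    fix x assume "rare_prefix P \<theta> (stake N x) u"
    then obtain l' where l': "sublist (take l' u) (stake N x)" "word_prob P (take l' u) < exp (- \<theta>)"
      by (auto simp: rare_prefix_def)
    then have "l \<le> l'" unfolding l_def by (intro Least_le)
    then have "sublist (take l u) (take l' u)" by (metis sublist_take take_take min_def)
    then show "sublist (take l u) (stake N x)" using l'(1) by (rule sublist_order.order.trans)
  qed
  then have "P.prob {x. rare_prefix P \<theta> (stake N x) u} \<le> P.prob {x. sublist (take l u) (stake N x)}"
    by (intro P.finite_measure_mono P.stake_pred_sets)
  also have "\<dots> \<le> real N * word_prob P (take l u)"
    using \<open>take l u \<noteq> []\<close> by (rule P.prob_sublist_le)
  also have "\<dots> \<le> real N * exp (- \<theta>)" using l by (intro mult_left_mono) auto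
  finally show ?thesis .
qed

lemma prob_rare_count_ge:
  assumes "0 \<le> \<theta>" "0 < c"
  shows "P.prob {x. c \<le> rare_count P \<theta> (stake N x) u} \<le> real (length u) * real N * exp (- \<theta>) / c"
proof -
  have int: "integrable P (\<lambda>x. of_bool (rare_prefix P \<theta> (stake N x) (drop t u)) :: real)" for t
    by (rule P.integrable_stake[of "\<lambda>x. of_bool (rare_prefix P \<theta> x (drop t u))"])
  have "P.prob {x \<in> space P. c \<le> rare_count P \<theta> (stake N x) u}
      \<le> (\<integral>x. rare_count P \<theta> (stake N x) u \<partial>P) / c"
    by (rule integral_Markov_inequality_measure[where A = "space P"])
       (use assms P.integrable_stake[of "\<lambda>x. rare_count P \<theta> x u"] in auto)
  also have "(\<integral>x. rare_count P \<theta> (stake N x) u \<partial>P)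
      = (\<Sum>t<length u. \<integral>x. of_bool (rare_prefix P \<theta> (stake N x) (drop t u)) \<partial>P)"
    unfolding rare_count_def using int by (intro Bochner_Integration.integral_sum)
  also have "\<dots> = (\<Sum>t<length u. P.prob {x. rare_prefix P \<theta> (stake N x) (drop t u)})"
  proof (rule sum.cong[OF refl])
    fix t
    have "(\<integral>x. (of_bool (rare_prefix P \<theta> (stake N x) (drop t u)) :: real) \<partial>P)
        = (\<integral>x. indicator {x. rare_prefix P \<theta> (stake N x) (drop t u)} x \<partial>P)"
      by (rule Bochner_Integration.integral_cong) (auto simp: indicator_def)
    then show "(\<integral>x. of_bool (rare_prefix P \<theta> (stake N x) (drop t u)) \<partial>P)
        = P.prob {x. rare_prefix P \<theta> (stake N x) (drop t u)}"
      by simp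
  qed
  also have "\<dots> \<le> (\<Sum>t<length u. real N * exp (- \<theta>))"
    by (intro sum_mono prob_rare_prefix_le assms)
  finally show ?thesis using assms by (simp add: divide_right_mono ac_simps)
qed

text \<open>Markov's inequality gives a bound of order N^(-\<epsilon>/2), which is summable along
  powers of 2 but not over all N. Monotonicity of \<open>rare_count\<close> fills in the values
  between.\<close>

lemma AE_rare_count_le:
  assumes \<epsilon>: "0 < \<epsilon>" "\<epsilon> \<le> 1"
  shows "AE w in P \<Otimes>\<^sub>M Q. \<forall>\<^sub>F N in sequentially. \<exists>\<theta>. 0 \<le> \<theta> \<and> \<theta> \<le> (1 + \<epsilon>) * ln (real N)
    \<and> rare_count P \<theta> (stake N (fst w)) (stake N (snd w)) \<le> real N powr (1 - \<epsilon> / 2)"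
proof -
  \<comment> \<open>For N between 2^j and 2^(j+1) the threshold and the bound are taken at the lower
    end and the words at the upper end, so that all comparisons go in the right direction.\<close>
  define \<theta> where "\<theta> j = (1 + \<epsilon>) * (real j * ln 2)" for j
  define c :: "nat \<Rightarrow> real" where "c j = 2 powr (real j * (1 - \<epsilon> / 2))" for j
  define s :: "nat \<Rightarrow> nat" where "s j = 2 ^ Suc j" for j
  have \<theta>: "0 \<le> \<theta> j" for j using \<epsilon> by (simp add: \<theta>_def)
  have c: "0 < c j" for j by (simp add: c_def)
  have "AE w in P \<Otimes>\<^sub>M Q. \<forall>\<^sub>F j in sequentially.
      \<not> c j \<le> rare_count P (\<theta> j) (stake (s j) (fst w)) (stake (s j) (snd w))"
  proof (rule AE_eventually_not_stake)
    show "P.prob {x. c j \<le> rare_count P (\<theta> j) (stake (s j) x) (stake (s j) y)}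
        \<le> 4 * (2 powr (- \<epsilon> / 2)) ^ j" for j y
    proof -
      have "P.prob {x. c j \<le> rare_count P (\<theta> j) (stake (s j) x) (stake (s j) y)}
          \<le> real (s j) * real (s j) * exp (- \<theta> j) / c j"
        using prob_rare_count_ge[OF \<theta>[of j] c[of j], where N = "s j" and u = "stake (s j) y"] by simp
      also have "real (s j) = 2 powr (real j + 1)" by (simp add: s_def powr_add powr_realpow)
      also have "exp (- \<theta> j) = 2 powr (- ((1 + \<epsilon>) * real j))" by (simp add: \<theta>_def powr_def)
      also have "2 powr (real j + 1) * 2 powr (real j + 1) * 2 powr (- ((1 + \<epsilon>) * real j)) / c j
          = 2 powr (2 + real j * (- \<epsilon> / 2))"
        unfolding c_def by (simp add: algebra_simps flip: powr_add powr_diff)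
      also have "\<dots> = 2 powr 2 * (2 powr (- \<epsilon> / 2)) powr real j"
        by (simp only: powr_add powr_powr mult.commute)
      also have "\<dots> = 4 * (2 powr (- \<epsilon> / 2)) ^ j"
        by (simp add: powr_realpow)
      finally show ?thesis .
    qed
    have "(2::real) powr (- \<epsilon> / 2) < 2 powr 0" using \<epsilon> by (intro powr_less_mono) auto
    then show "summable (\<lambda>j. 4 * (2 powr (- \<epsilon> / 2)) ^ j :: real)"
      by (intro summable_mult summable_geometric) simp
  qed
  then show ?thesis
  proof eventually_elim
    case (elim w)
    define J where "J N = nat \<lfloor>log 2 (real N)\<rfloor>" for N :: nat
    have "filterlim J at_top sequentially" unfolding J_def by real_asymp
    with elim have "\<forall>\<^sub>F N in sequentially.
        \<not> c (J N) \<le> rare_count P (\<theta> (J N)) (stake (s (J N)) (fst w)) (stake (s (J N)) (snd w))"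
      by (rule eventually_compose_filterlim)
    then show ?case using eventually_ge_at_top[of 1]
    proof eventually_elim
      case (elim N)
      have log: "0 \<le> log 2 (real N)" using elim by simp
      have J: "real (J N) \<le> log 2 (real N)" "log 2 (real N) < real (J N) + 1"
        unfolding J_def using log by linarith+
      have "2 powr log 2 (real N) < 2 powr (real (J N) + 1)" using J by (intro powr_less_mono) auto
      then have "real N < real (s (J N))" using elim by (simp add: s_def powr_add powr_realpow)
      then have N: "N \<le> s (J N)" by linarith
      have "sublist (stake N (fst w)) (stake (s (J N)) (fst w))"
        using N sublist_take[of N "stake (s (J N)) (fst w)"] by (simp add: take_stake min_absorb1)
      moreover have "stake (s (J N)) (snd w) = stake N (snd w) @ drop N (stake (s (J N)) (snd w))"
        using N append_take_drop_id[of N "stake (s (J N)) (snd w)"] by (simp add: take_stake min_absorb1)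
      ultimately have "rare_count P (\<theta> (J N)) (stake N (fst w)) (stake N (snd w))
          \<le> rare_count P (\<theta> (J N)) (stake (s (J N)) (fst w)) (stake (s (J N)) (snd w))"
        by (metis rare_count_mono)
      also have "\<dots> \<le> c (J N)" using elim by simp
      also have "\<dots> \<le> 2 powr (log 2 (real N) * (1 - \<epsilon> / 2))"
        unfolding c_def using J \<epsilon> by (intro powr_mono mult_right_mono) auto
      also have "\<dots> = real N powr (1 - \<epsilon> / 2)" using elim by (simp flip: powr_powr)
      finally have "rare_count P (\<theta> (J N)) (stake N (fst w)) (stake N (snd w)) \<le> real N powr (1 - \<epsilon> / 2)" .
      moreover have "\<theta> (J N) \<le> (1 + \<epsilon>) * ln (real N)"
      proof -
        have "real (J N) * ln 2 \<le> log 2 (real N) * ln 2" using J by (intro mult_right_mono) auto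
        also have "\<dots> = ln (real N)" by (simp add: log_def)
        finally show ?thesis unfolding \<theta>_def using \<epsilon> by (intro mult_left_mono) auto
      qed
      ultimately show ?case using \<theta> by blast
    qed
  qed
qed

end

section \<open>Nondegeneracy and logarithmic word lengths\<close>

locale estimator_setting = cross_pair P Q k \<tau> + S: selectively_decoupled_below P \<kappa> \<sigma>
  for P Q :: "'a::finite stream measure" and k \<tau> \<kappa> \<sigma> +
  assumes nondegenerate: "nondegenerate P Q"
begin

text \<open>At \<alpha> = -1 the moment generating function is the expected
  \<open>P\<close>-probability of a prefix drawn from \<open>Q\<close>, so nondegeneracy is its
  exponential decay.\<close>

lemma overlap_decay:
  obtains \<gamma> where "\<gamma> > 0"
    "\<forall>\<^sub>F n in sequentially. (\<integral>y. word_prob P (stake n y) \<partial>Q) \<le> exp (- \<gamma> * real n)"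
proof -
  obtain r where r: "cross_entropic_pressure P Q (- 1) < ereal r" "ereal r < 0"
    using nondegenerate ereal_dense2 unfolding nondegenerate_def by blast
  have "(\<integral>y. exp (- 1 * surprisal P (stake n y)) \<partial>Q) = (\<integral>y. word_prob P (stake n y) \<partial>Q)" for n
    using AE_supp by (intro integral_cong_AE) (auto simp: supp_def P.exp_neg_surprisal)
  then have "\<forall>\<^sub>F n in sequentially. (\<integral>y. word_prob P (stake n y) \<partial>Q) \<le> exp (- (- r) * real n)"
    using pressure_lessD[OF r(1)] by simp
  moreover have "- r > 0" using r(2) by simp
  ultimately show thesis using that by blast
qed

text \<open>Only words of y of length O(ln N) can have \<open>P\<close>-probability at least 1/N.
  This keeps both the number of words to be found in x and their decoupling errors small.\<close>

lemma AE_long_words_unlikely: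
  obtains C where "C > 0"
    "AE y in Q. \<forall>\<^sub>F N in sequentially. \<forall>t<N. word_prob P (stake (nat \<lceil>C * ln (real N)\<rceil>) (sdrop t y)) < 1 / real N"
proof -
  obtain \<gamma> where \<gamma>: "\<gamma> > 0"
    "\<forall>\<^sub>F n in sequentially. (\<integral>y. word_prob P (stake n y) \<partial>Q) \<le> exp (- \<gamma> * real n)"
    by (rule overlap_decay)
  \<comment> \<open>The exponent 4 pays for N starting points and a factor N from Markov's
    inequality, and leaves the summable 1/N^2.\<close>
  define C where "C = 4 / \<gamma>"
  have "C > 0" using \<gamma> by (simp add: C_def)
  define n where "n N = nat \<lceil>C * ln (real N)\<rceil>" for N :: nat
  define E where "E N = (\<Union>t<N. {y. sdrop t y \<in> {y. 1 / real N \<le> word_prob P (stake (n N) y)}})" for N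
  have [measurable]: "{y. 1 / real N \<le> word_prob P (stake (n N) y)} \<in> sets Q" for N
    by (rule Q.stake_pred_sets)
  have sd [measurable]: "{y. sdrop t y \<in> {y. 1 / real N \<le> word_prob P (stake (n N) y)}} \<in> sets Q" for N t
    using measurable_sets[OF Q.measurable_sdrop_inv, of "{y. 1 / real N \<le> word_prob P (stake (n N) y)}" t]
    by (simp add: vimage_def)
  have [measurable]: "E N \<in> sets Q" for N unfolding E_def by measurable
  have "filterlim n at_top sequentially"
    unfolding n_def using \<open>C > 0\<close> by real_asymp
  with \<gamma>(2) have "\<forall>\<^sub>F N in sequentially. (\<integral>y. word_prob P (stake (n N) y) \<partial>Q) \<le> exp (- \<gamma> * real (n N))"
    by (rule eventually_compose_filterlim)
  then have "\<forall>\<^sub>F N in sequentially. norm (Q.prob (E N)) \<le> inverse (real N ^ 2)"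
    using eventually_gt_at_top[of 0]
  proof eventually_elim
    case (elim N)
    have "Q.prob (E N) \<le> (\<Sum>t<N. Q.prob {y. sdrop t y \<in> {y. 1 / real N \<le> word_prob P (stake (n N) y)}})"
      unfolding E_def using sd by (intro Q.finite_measure_subadditive_finite) auto
    also have "\<dots> = real N * Q.prob {y \<in> space Q. 1 / real N \<le> word_prob P (stake (n N) y)}"
      by (subst Q.prob_sdrop) auto
    also have "\<dots> \<le> real N * ((\<integral>y. word_prob P (stake (n N) y) \<partial>Q) / (1 / real N))"
      using elim by (intro mult_left_mono integral_Markov_inequality_measure[where A = "space Q"]
        Q.integrable_stake) auto
    also have "\<dots> \<le> real N * (exp (- \<gamma> * real (n N)) / (1 / real N))"
      using elim by (intro mult_left_mono divide_right_mono) auto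
    also have "exp (- \<gamma> * real (n N)) \<le> exp (- 4 * ln (real N))"
    proof -
      have "\<gamma> * (C * ln (real N)) \<le> \<gamma> * real (n N)"
        using \<gamma>(1) unfolding n_def by (intro mult_left_mono) linarith+
      then show ?thesis using \<gamma>(1) by (simp add: C_def)
    qed
    also have "\<dots> = inverse (real N ^ 4)"
      using elim(2) by (simp add: exp_minus exp_of_nat_mult[of 4, simplified])
    finally show ?case using elim(2) by (simp add: power_numeral_reduce field_simps)
  qed
  then have "summable (\<lambda>N. Q.prob (E N))"
    by (rule summable_comparison_test_ev) (use inverse_power_summable[of 2] in simp)
  then have "AE y in Q. \<forall>\<^sub>F N in sequentially. y \<in> space Q - E N"
    by (intro borel_cantelli_AE1) (auto simp: Q.emeasure_eq_measure)
  then have "AE y in Q. \<forall>\<^sub>F N in sequentially. \<forall>t<N. word_prob P (stake (nat \<lceil>C * ln (real N)\<rceil>) (sdrop t y)) < 1 / real N"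
  proof eventually_elim
    case (elim y)
    then show ?case by eventually_elim (auto simp: E_def n_def not_le)
  qed
  then show thesis using that \<open>C > 0\<close> by blast
qed

end

lemma smallo_linear_bound:
  fixes k :: "nat \<Rightarrow> real"
  assumes "k \<in> o(\<lambda>n. real n)" "0 < \<eta>"
  obtains K where "0 \<le> K" "\<And>n. k n \<le> \<eta> * real n + K"
proof -
  have "\<forall>\<^sub>F n in sequentially. norm (k n) \<le> \<eta> * norm (real n)"
    by (rule landau_o.smallD[OF assms])
  then obtain n0 where n0: "\<And>n. n \<ge> n0 \<Longrightarrow> norm (k n) \<le> \<eta> * norm (real n)"
    by (auto simp: eventually_sequentially)
  define K where "K = (\<Sum>i<n0. \<bar>k i\<bar>)"
  have "k n \<le> \<eta> * real n + K" for n
  proof (cases "n < n0")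
    case True
    then have "\<bar>k n\<bar> \<le> K" unfolding K_def by (intro member_le_sum) auto
    moreover have "0 \<le> \<eta> * real n" using assms(2) by simp
    ultimately show ?thesis by linarith
  next
    case False
    have "0 \<le> K" unfolding K_def by (intro sum_nonneg) auto
    then show ?thesis using n0[of n] False by simp
  qed
  moreover have "0 \<le> K" unfolding K_def by (intro sum_nonneg) auto
  ultimately show thesis using that by blast
qed

lemma mZM_estimator_nonneg: "0 \<le> mZM_estimator N y x"
  using mZM_count_le[of N y x]
  by (cases "N = 0") (auto simp: mZM_estimator_def intro!: divide_nonneg_nonneg mult_nonneg_nonneg)

context estimator_setting
begin

text \<open>About N ln N words of y are short enough to matter, up to a constant factor, and each is
  missing from x with probability at most \<open>exp (2 - B N)\<close>. Longer words have a prefix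
  of probability below 1/N and miss the threshold.\<close>

lemma AE_frequent_words_occur:
  assumes \<epsilon>: "0 < \<epsilon>"
  shows "AE w in P \<Otimes>\<^sub>M Q. \<forall>\<^sub>F N in sequentially. \<forall>u. sublist u (stake N (snd w)) \<longrightarrow>
    real N powr (\<epsilon> - 1) \<le> word_prob P u \<longrightarrow> sublist u (stake N (fst w))"
proof -
  obtain C where C: "C > 0"
    "AE y in Q. \<forall>\<^sub>F N in sequentially. \<forall>t<N. word_prob P (stake (nat \<lceil>C * ln (real N)\<rceil>) (sdrop t y)) < 1 / real N"
    by (rule AE_long_words_unlikely)
  define n where "n N = nat \<lceil>C * ln (real N)\<rceil>" for N :: nat
  \<comment> \<open>With this slope the error at lengths up to \<open>C * ln (real N) + 1\<close> is
    at most (\<epsilon>/4) ln N plus a constant. So \<open>B N\<close> is of order N^(3\<epsilon>/4)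
    / ln N, and \<open>exp (- B N)\<close> beats every power of N.\<close>
  obtain K where K: "0 \<le> K" "\<And>l. \<kappa> l \<le> \<epsilon> / (4 * C) * real l + K"
    by (rule smallo_linear_bound[OF S.\<kappa>_small, of "\<epsilon> / (4 * C)"]) (use \<epsilon> C in auto)
  define R where "R N x Y \<longleftrightarrow> (\<exists>t<N. \<exists>l\<in>{1..n N}. real N powr (\<epsilon> - 1) \<le> word_prob P (take l (drop t Y))
      \<and> \<not> sublist (take l (drop t Y)) x)" for N and x Y :: "'a list"
  define B where "B N = exp (- (\<epsilon> / (4 * C) * (C * ln (real N) + 1) + K)) * real N powr (\<epsilon> - 1) * real N
      / (C * ln (real N) + 1 + real \<sigma>)" for N
  define b where "b N = (if N = 0 then 1 else real N * (C * ln (real N) + 1) * exp (2 - B N))" for N :: nat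
  \<comment> \<open>Reading \<open>n N\<close> letters of y beyond N ensures that all words
    inspected by \<open>R\<close> have their full length.\<close>
  have AE_R: "AE w in P \<Otimes>\<^sub>M Q. \<forall>\<^sub>F N in sequentially. \<not> R N (stake N (fst w)) (stake (N + n N) (snd w))"
  proof (rule AE_eventually_not_stake)
    fix N :: nat and y :: "'a stream"
    define Y where "Y = stake (N + n N) y"
    show "P.prob {x. R N (stake N x) (stake (N + n N) y)} \<le> b N"
    proof (cases "N = 0")
      case True
      then show ?thesis by (simp add: b_def)
    next
      case False
      then have ln: "0 \<le> ln (real N)" by simp
      have nN: "real (n N) \<le> C * ln (real N) + 1"
        using mult_nonneg_nonneg[of C "ln (real N)"] C ln unfolding n_def by linarith
      define F where "F t l = {x. real N powr (\<epsilon> - 1) \<le> word_prob P (take l (drop t Y))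
        \<and> \<not> sublist (take l (drop t Y)) (stake N x)}" for t l
      have [measurable]: "F t l \<in> sets P" for t l unfolding F_def by (rule P.stake_pred_sets)
      have F: "P.prob (F t l) \<le> exp (2 - B N)" if "t < N" "l \<in> {1..n N}" for t l
      proof (cases "real N powr (\<epsilon> - 1) \<le> word_prob P (take l (drop t Y))")
        case True
        define u where "u = take l (drop t Y)"
        have u: "length u = l" "u \<noteq> []" using that by (auto simp: u_def Y_def)
        have "0 < real N powr (\<epsilon> - 1)" using False by simp
        then have pos: "0 < word_prob P u" using True unfolding u_def by linarith
        have "B N \<le> exp (- \<kappa> l) * word_prob P u * real N / real (l + \<sigma>)"
        proof -
          have "real l \<le> C * ln (real N) + 1" using that nN by simp
          then have "\<epsilon> / (4 * C) * real l \<le> \<epsilon> / (4 * C) * (C * ln (real N) + 1)"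
            using \<epsilon> C by (intro mult_left_mono) auto
          then have "\<kappa> l \<le> \<epsilon> / (4 * C) * (C * ln (real N) + 1) + K"
            using K(2)[of l] by linarith
          moreover have "real (l + \<sigma>) \<le> C * ln (real N) + 1 + real \<sigma>" "0 < real (l + \<sigma>)"
            using that nN by auto
          ultimately show ?thesis
            unfolding B_def using True
            by (intro frac_le mult_mono) (auto simp: u_def)
        qed
        then have "2 - exp (- \<kappa> l) * word_prob P u * real N / real (l + \<sigma>) \<le> 2 - B N" by simp
        have "P.prob (F t l) \<le> P.prob {x. \<not> sublist u (stake N x)}"
          by (intro P.finite_measure_mono P.stake_pred_sets) (auto simp: F_def u_def)
        also have "\<dots> \<le> exp (2 - exp (- \<kappa> l) * word_prob P u * real N / real (l + \<sigma>))"
          using S.prob_not_sublist_le[OF u(2) pos, of N] by (simp add: u(1))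
        also have "\<dots> \<le> exp (2 - B N)"
          using \<open>2 - exp (- \<kappa> l) * word_prob P u * real N / real (l + \<sigma>) \<le> 2 - B N\<close> by simp
        finally show ?thesis .
      next
        case False
        then have "F t l = {}" by (auto simp: F_def)
        then show ?thesis by simp
      qed
      have "{x. R N (stake N x) (stake (N + n N) y)} = (\<Union>(t, l)\<in>{..<N} \<times> {1..n N}. F t l)"
        by (auto simp: R_def F_def Y_def)
      then have "P.prob {x. R N (stake N x) (stake (N + n N) y)} = P.prob (\<Union>(t, l)\<in>{..<N} \<times> {1..n N}. F t l)"
        by simp
      also have "\<dots> \<le> (\<Sum>(t, l)\<in>{..<N} \<times> {1..n N}. P.prob (F t l))"
        unfolding case_prod_beta by (intro P.finite_measure_subadditive_finite) auto
      also have "\<dots> \<le> (\<Sum>(t, l)\<in>{..<N} \<times> {1..n N}. exp (2 - B N))"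
        by (intro sum_mono) (auto intro!: F simp del: atLeastAtMost_iff)
      also have "\<dots> = real N * real (n N) * exp (2 - B N)" by (simp add: case_prod_beta)
      also have "\<dots> \<le> real N * (C * ln (real N) + 1) * exp (2 - B N)"
        using nN by (intro mult_right_mono mult_left_mono) auto
      finally show ?thesis using False by (simp add: b_def)
    qed
  next
    have "\<forall>\<^sub>F N in sequentially. b N = real N * (C * ln (real N) + 1) * exp (2 - B N)"
      using eventually_gt_at_top[of 0] by eventually_elim (simp add: b_def)
    moreover have "(\<lambda>N. real N * (C * ln (real N) + 1) * exp (2 - B N)) \<in> O(\<lambda>N. 1 / real N ^ 2)"
      unfolding B_def using \<epsilon> C(1) by real_asymp
    ultimately have "b \<in> O(\<lambda>N. 1 / real N ^ 2)"
      by (simp only: landau_o.big.in_cong)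
    then show "summable b"
      by (rule summable_comparison_test_bigo[rotated])
         (use inverse_power_summable[of 2, where ?'a = real] in \<open>simp add: divide_inverse\<close>)
  qed
  show ?thesis
    using AE_R AE_snd[OF C(2)]
  proof eventually_elim
    case (elim w)
    show ?case using elim(1) elim(2) eventually_gt_at_top[of 1]
    proof eventually_elim
      case (elim N)
      show ?case
      proof (intro allI impI)
        fix u assume u: "sublist u (stake N (snd w))" "real N powr (\<epsilon> - 1) \<le> word_prob P u"
        obtain t where t: "t + length u \<le> N" "stake (length u) (sdrop t (snd w)) = u"
          using u(1) unfolding sublist_stake_iff by blast
        consider "u = []" | "u \<noteq> []" "length u \<le> n N" | "n N < length u" by fastforce
        then show "sublist u (stake N (fst w))"
        proof cases
          case 2
          then have "t < N" using t by (cases u) auto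
          have e: "take (length u) (drop t (stake (N + n N) (snd w))) = u"
            using t stake_sdrop_eq_take_drop[of t "length u" "N + n N" "snd w"] by simp
          have "length u \<in> {1..n N}" using 2 by (simp add: Suc_le_eq)
          then show ?thesis
            using elim(1) \<open>t < N\<close> u(2) e unfolding R_def by metis
        next
          case 3
          then have "t < N" using t by linarith
          have "stake (n N) (sdrop t (snd w)) = take (n N) u"
            using 3 t(2) by (metis take_stake min.strict_order_iff min.commute)
          then have "word_prob P u \<le> word_prob P (stake (n N) (sdrop t (snd w)))"
            by (simp add: P.word_prob_sublist_mono)
          also have "\<dots> < 1 / real N" using elim(2) \<open>t < N\<close> by (simp add: n_def)
          also have "\<dots> = real N powr - 1" using elim(3) by (simp add: powr_minus_divide)
          also have "\<dots> \<le> real N powr (\<epsilon> - 1)" using \<epsilon> elim(3) by (intro powr_mono) auto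
          finally show ?thesis using u(2) by simp
        qed simp
      qed
    qed
  qed
qed

end

section \<open>Asymptotics of the estimator\<close>

context cross_pair
begin

text \<open>The lower bound on Birkhoff sums meets the upper bound by the parsing: the terms
  \<open>k n\<close> cancel and the factor \<open>n + \<tau>\<close> drops out in the limit. The
  number of rare positions is o(N / ln N), and replacing N - c by N only lowers the
  estimator.\<close>

lemma AE_liminf_estimator_ge:
  assumes "\<beta> > 0" and z: "0 < z" "z < \<mu>"
    and mgf: "\<forall>\<^sub>F n in sequentially. (\<integral>y. exp (- \<beta> * surprisal P (stake n y)) \<partial>Q) \<le> exp (- \<beta> * \<mu> * real n)"
  shows "AE w in P \<Otimes>\<^sub>M Q. ereal z \<le> liminf (\<lambda>N. mZM_estimator N (snd w) (fst w))"
proof -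
  define z' where "z' = (z + \<mu>) / 2"
  have z': "z < z'" "z' < \<mu>" using z by (auto simp: z'_def)
  define \<rho> where "\<rho> = z' / z"
  have \<rho>: "1 < \<rho>" "z' = \<rho> * z" using z z' by (simp_all add: \<rho>_def)
  \<comment> \<open>Chosen so that z' / (1 + \<epsilon>) still exceeds z, which absorbs the excess
    of \<theta> over ln N.\<close>
  define \<epsilon> where "\<epsilon> = min 1 ((\<rho> - 1) / 2)"
  have \<epsilon>: "0 < \<epsilon>" "\<epsilon> \<le> 1" "1 + \<epsilon> < \<rho>" using \<rho>(1) by (auto simp: \<epsilon>_def min_def field_simps)
  have \<epsilon>z: "z < z' / (1 + \<epsilon>)"
    using \<epsilon> z mult_strict_right_mono[OF \<epsilon>(3), of z] by (simp add: \<rho>(2) less_divide_eq mult.commute)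
  show ?thesis
    using AE_rare_count_le[OF \<epsilon>(1,2)] AE_snd[OF AE_not_low_density[OF \<open>\<beta> > 0\<close> z'(2) mgf]] AE_snd[OF AE_supp]
  proof eventually_elim
    case (elim w)
    define x y where "x = fst w" and "y = snd w"
    have y_supp: "y \<in> supp P" using elim by (simp add: y_def)
    obtain n where n: "n \<ge> 1" "y \<notin> low_density n (real (n + \<tau>) * z' + k n)"
      using elim(2) by (auto simp: y_def)
    obtain K where K: "\<forall>\<^sub>F N in sequentially. (real (n + \<tau>) * z' + k n) * real N - K \<le> birkhoff_sum P n N y"
      using n(2) by (rule not_low_densityD)
    define D where "D = (3 * real n + 2) * P.max_surprisal n"
    define K' where "K' = K + real n * P.max_surprisal n"
    define p where "p = real (n + \<tau>)"
    have p: "p > 0" using n(1) by (simp add: p_def)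
    have D: "D \<ge> 0" by (simp add: D_def)
    define low where "low N = (p * z' * real N - K') / (p * ((1 + \<epsilon>) * ln (real N)) + D) - real N powr (1 - \<epsilon> / 2)" for N :: nat
    have "\<forall>\<^sub>F N in sequentially. low N \<le> real (mZM_count N y x)"
      using K elim(1) eventually_gt_at_top[of 1]
    proof eventually_elim
      case (elim N)
      obtain \<theta> where \<theta>: "0 \<le> \<theta>" "\<theta> \<le> (1 + \<epsilon>) * ln (real N)"
          "rare_count P \<theta> (stake N x) (stake N y) \<le> real N powr (1 - \<epsilon> / 2)"
        using elim(2) by (auto simp: x_def y_def)
      define S where "S = real (mZM_count N y x) + real N powr (1 - \<epsilon> / 2)"
      have "S \<ge> 0" by (simp add: S_def)
      have "window_sum P n (stake N y) \<le> real N * k n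
          + (real (mZM_count N y x) + rare_count P \<theta> (stake N x) (stake N y)) * (p * \<theta> + D)"
        using P.window_sum_concat_le[of "mZM_parse (stake N x) (stake N y)" n \<theta> "stake N x",
            OF _ n(1) \<theta>(1) mZM_parse_word] y_supp[unfolded supp_def]
        by (simp add: mZM_count_def p_def D_def)
      also have "(real (mZM_count N y x) + rare_count P \<theta> (stake N x) (stake N y)) * (p * \<theta> + D)
          \<le> S * (p * ((1 + \<epsilon>) * ln (real N)) + D)"
        using \<theta> p D \<open>S \<ge> 0\<close> by (intro mult_mono add_mono mult_left_mono) (auto simp: S_def)
      finally have "(p * z' + k n) * real N - K
          \<le> real N * k n + S * (p * ((1 + \<epsilon>) * ln (real N)) + D) + real n * P.max_surprisal n"
        using elim(1) P.birkhoff_sum_le_window_sum[of n N y] by (simp add: p_def)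
      then have "p * z' * real N - K' \<le> S * (p * ((1 + \<epsilon>) * ln (real N)) + D)"
        by (simp add: K'_def algebra_simps)
      moreover have "0 < p * ((1 + \<epsilon>) * ln (real N)) + D"
        using p D \<epsilon> elim(3) by (intro add_pos_nonneg mult_pos_pos) auto
      ultimately have "(p * z' * real N - K') / (p * ((1 + \<epsilon>) * ln (real N)) + D) \<le> S"
        by (simp add: pos_divide_le_eq)
      then show ?case by (simp add: low_def S_def)
    qed
    moreover have "\<forall>\<^sub>F N in sequentially. z < low N * ln (real N) / real N"
    proof -
      have "((\<lambda>N. low N * ln (real N) / real N) \<longlongrightarrow> p * z' * (inverse p * inverse (1 + \<epsilon>))) sequentially"
        unfolding low_def using p \<epsilon> by real_asymp
      also have "p * z' * (inverse p * inverse (1 + \<epsilon>)) = z' / (1 + \<epsilon>)"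
        using p by (simp add: divide_inverse)
      finally show ?thesis using \<epsilon>z by (rule order_tendstoD)
    qed
    ultimately have "\<forall>\<^sub>F N in sequentially. ereal z \<le> mZM_estimator N y x"
      using eventually_gt_at_top[of 1]
    proof eventually_elim
      case (elim N)
      define c where "c = mZM_count N y x"
      show ?case
      proof (cases "c = N")
        case False
        then have c: "c < N" using mZM_count_le[of N y x] by (simp add: c_def)
        have "z \<le> low N * ln (real N) / real N" using elim by simp
        also have "\<dots> \<le> real c * ln (real N) / (real N - real c)"
          using elim c by (intro frac_le mult_right_mono) (auto simp: c_def)
        finally show ?thesis using False by (simp add: mZM_estimator_def c_def)
      qed (simp add: mZM_estimator_def c_def)
    qed
    then show "ereal z \<le> liminf (\<lambda>N. mZM_estimator N (snd w) (fst w))"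
      unfolding x_def y_def by (rule Liminf_bounded)
  qed
qed

end

context estimator_setting
begin

text \<open>For a given y a level is found that the surprisal rate exceeds by no more than the mesh
  \<delta> and that the window rate of some n, divided by \<open>n + \<tau>\<close>, reaches up to
  \<delta>. The bound on alternately trimmed words then leaves one surprisal rate for c_N ln N /
  N.\<close>

lemma AE_limsup_estimator_le:
  assumes \<alpha>: "\<alpha> > 0" and z: "0 < \<mu>" "\<mu> < z"
    and mgf: "\<forall>\<^sub>F n in sequentially. (\<integral>y. exp (\<alpha> * surprisal P (stake n y)) \<partial>Q) \<le> exp (\<alpha> * \<mu> * real n)"
  shows "AE w in P \<Otimes>\<^sub>M Q. limsup (\<lambda>N. mZM_estimator N (snd w) (fst w)) \<le> ereal z"
proof -
  \<comment> \<open>The errors below add up to the rate \<mu> + 6\<delta>, while z (1 - \<epsilon>)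
    = z - 4\<delta> = \<mu> + 12\<delta>.\<close>
  define \<delta> where "\<delta> = (z - \<mu>) / 16"
  define \<epsilon> where "\<epsilon> = 4 * \<delta> / z"
  have \<delta>: "0 < \<delta>" using z by (simp add: \<delta>_def)
  have \<epsilon>: "0 < \<epsilon>" "\<epsilon> < 1" using z by (auto simp: \<epsilon>_def \<delta>_def field_simps)
  have "z * (1 - \<epsilon>) = z - 4 * \<delta>" using z by (simp add: \<epsilon>_def field_simps)
  moreover have "z = \<mu> + 16 * \<delta>" by (simp add: \<delta>_def field_simps)
  ultimately have "\<mu> + 6 * \<delta> < z * (1 - \<epsilon>)" using \<delta> by linarith
  then have rate: "(\<mu> + 6 * \<delta>) / (1 - \<epsilon>) < z"
    using \<epsilon> by (simp add: pos_divide_less_eq)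
  obtain K\<eta> where K\<eta>: "0 \<le> K\<eta>" "\<And>n. k n \<le> \<delta> * real n + K\<eta>"
    using smallo_linear_bound[OF P.k_small \<delta>] by blast
  \<comment> \<open>The rate depends on y and is therefore only located on a countable grid, so that
    a single null set serves all levels. Level 0 is negative and hence always exceeded.\<close>
  define level where "level m = \<delta> * real m - \<delta>" for m :: nat
  define unbdd where "unbdd m y \<longleftrightarrow> (\<forall>K::nat. \<exists>\<^sub>F N in sequentially. level m * real N + real K \<le> surprisal P (stake N y))"
    for m y
  have "AE y in Q. unbdd m y \<longrightarrow> (\<exists>n\<ge>1. y \<notin> low_density n (real (n + \<tau>) * (level m - \<delta>) + k n))" for m
    unfolding unbdd_def using \<delta> by (intro AE_surprisal_unbounded_imp_not_low_density) simp
  then have AE_density: "AE y in Q. \<forall>m. unbdd m y \<longrightarrow>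
      (\<exists>n\<ge>1. y \<notin> low_density n (real (n + \<tau>) * (level m - \<delta>) + k n))"
    by (subst AE_all_countable) blast
  have AE_growth: "AE y in Q. \<forall>\<^sub>F N in sequentially. surprisal P (stake N y) \<le> (\<mu> + \<delta>) * real N"
    using \<delta> by (intro AE_surprisal_le[OF \<alpha> _ mgf]) simp
  show ?thesis
    using AE_frequent_words_occur[OF \<epsilon>(1)] AE_snd[OF AE_density] AE_snd[OF AE_growth] AE_snd[OF AE_supp]
  proof eventually_elim
    case (elim w)
    define x y where "x = fst w" and "y = snd w"
    have y_supp: "y \<in> supp P" using elim by (simp add: y_def)
    have growth: "\<forall>\<^sub>F N in sequentially. surprisal P (stake N y) \<le> (\<mu> + \<delta>) * real N"
      using elim(3) by (simp add: y_def)
    have level_le: "level m \<le> \<mu> + \<delta>" if "unbdd m y" for m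
    proof -
      have "\<exists>\<^sub>F N in sequentially. level m * real N + real 0 \<le> surprisal P (stake N y)"
        using that unfolding unbdd_def by (rule spec)
      from frequently_ex[OF frequently_eventually_frequently[OF this eventually_conj[OF growth eventually_gt_at_top[of 0]]]]
      obtain N where "level m * real N + real 0 \<le> surprisal P (stake N y)"
          "surprisal P (stake N y) \<le> (\<mu> + \<delta>) * real N" "N > 0"
        by (elim exE conjE)
      then have "level m * real N \<le> (\<mu> + \<delta>) * real N" by linarith
      then show ?thesis using \<open>N > 0\<close> by simp
    qed
    have "unbdd 0 y"
      unfolding unbdd_def
    proof
      fix K :: nat
      have "\<forall>\<^sub>F N in sequentially. level 0 * real N + real K \<le> 0"
        unfolding level_def using \<delta> by real_asymp
      then have "\<forall>\<^sub>F N in sequentially. level 0 * real N + real K \<le> surprisal P (stake N y)"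
        by eventually_elim (use P.surprisal_nonneg order.trans in blast)
      then show "\<exists>\<^sub>F N in sequentially. level 0 * real N + real K \<le> surprisal P (stake N y)"
        by (intro eventually_frequently) simp_all
    qed
    moreover have "\<not> (\<forall>m. unbdd m y)"
    proof
      assume "\<forall>m. unbdd m y"
      moreover obtain m :: nat where "(\<mu> + 2 * \<delta>) / \<delta> < real m" using reals_Archimedean2 by blast
      ultimately show False
        using \<delta> level_le[of m] by (simp add: level_def pos_divide_less_eq mult.commute)
    qed
    \<comment> \<open>Passing the level m but not the next one pins down the upper growth rate of
      the surprisal along this y up to \<delta>.\<close>
    ultimately obtain m where m: "unbdd m y" "\<not> unbdd (Suc m) y"
      using nat_induct[of "\<lambda>m. unbdd m y"] by blast
    obtain n where n: "n \<ge> 1" "y \<notin> low_density n (real (n + \<tau>) * (level m - \<delta>) + k n)"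
      using elim(2) m(1) by (auto simp: y_def)
    obtain K1 where K1: "\<forall>\<^sub>F N in sequentially.
        (real (n + \<tau>) * (level m - \<delta>) + k n) * real N - K1 \<le> birkhoff_sum P n N y"
      using n(2) by (rule not_low_densityD)
    obtain K2 :: nat where "\<forall>\<^sub>F N in sequentially. \<not> level (Suc m) * real N + real K2 \<le> surprisal P (stake N y)"
      using m(2) by (auto simp: unbdd_def not_frequently)
    then have K2: "\<forall>\<^sub>F N in sequentially. surprisal P (stake N y) \<le> (level m + \<delta>) * real N + real K2"
      by eventually_elim (simp add: level_def algebra_simps)
    define K4 where "K4 = 2 * K\<eta> + 5 * P.max_surprisal n"
    define K5 where "K5 = 2 * real K2 + (K1 + real n * P.max_surprisal n) / real (n + \<tau>)"
    define up where "up N = ((\<mu> + 6 * \<delta>) * real N + K5 + (1 - \<epsilon>) * ln (real N)) / ((1 - \<epsilon>) * ln (real N) - K4)"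
      for N :: nat
    have "\<forall>\<^sub>F N in sequentially. P.max_surprisal (2 * \<tau>) < (1 - \<epsilon>) * ln (real N)"
      "\<forall>\<^sub>F N in sequentially. K4 < (1 - \<epsilon>) * ln (real N)"
      using \<epsilon> by real_asymp+
    then have "\<forall>\<^sub>F N in sequentially. real (mZM_count N y x) \<le> up N"
      using K1 K2 elim(1) eventually_gt_at_top[of 1]
    proof eventually_elim
      case (elim N)
      let ?Y = "stake N y"
      define ws where "ws = mZM_parse (stake N x) ?Y"
      define c where "c = real (mZM_count N y x)"
      have c: "c = real (length ws)" by (simp add: c_def mZM_count_def ws_def)
      have Y: "concat ws = ?Y" by (simp add: ws_def)
      have posY: "0 < word_prob P ?Y" using y_supp by (simp add: supp_def)
      have L: "(1 - \<epsilon>) * ln (real N) \<le> surprisal P v" if v: "v \<in> set (butlast ws)" for v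
      proof -
        have "v \<in> set ws" using v by (rule in_set_butlastD)
        then have "sublist v ?Y" unfolding Y[symmetric]
          by (metis concat.simps(2) concat_append split_list sublist_appendI)
        moreover have "\<not> sublist v (stake N x)" using v unfolding ws_def by (rule not_sublist_mZM_parse)
        ultimately have less: "word_prob P v < real N powr (\<epsilon> - 1)"
          using elim(5) unfolding x_def y_def by (meson not_le)
        have pos: "0 < word_prob P v" using posY \<open>sublist v ?Y\<close> by (rule P.word_prob_pos_sublist)
        have "ln (word_prob P v) < ln (real N powr (\<epsilon> - 1))"
          using less pos elim(6) by (subst ln_less_cancel_iff) auto
        then show ?thesis using elim(6) by (simp add: surprisal_def ln_powr algebra_simps)
      qed
      have "(real (length ws) - 1) * ((1 - \<epsilon>) * ln (real N))
          + (window_sum P n (concat ws) - real (length (concat ws)) * k n) / real (n + \<tau>)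
        \<le> 2 * surprisal P (concat ws) + 2 * \<delta> * real (length (concat ws))
          + (2 * K\<eta> + 5 * P.max_surprisal n) * real (length ws)"
      proof (rule P.sum_surprisal_le)
        show "v \<noteq> []" if "v \<in> set ws" for v using that mZM_parse_word unfolding ws_def by blast
        \<comment> \<open>The surprisal of v exceeds that of every word of length at most
          2\<tau>.\<close>
        show "2 * \<tau> < length v" if v: "v \<in> set (butlast ws)" for v
          using L[OF v] elim(1) P.surprisal_le_max[of v "2 * \<tau>"] by linarith
        show "ws \<noteq> []" using elim(6) by (auto simp: ws_def mZM_parse_eq_Nil_iff)
      qed (use posY n(1) K\<eta>(2) \<delta> L in \<open>auto simp: Y\<close>)
      then have main: "(c - 1) * ((1 - \<epsilon>) * ln (real N))
          + (window_sum P n ?Y - real N * k n) / real (n + \<tau>)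
        \<le> 2 * surprisal P ?Y + 2 * \<delta> * real N + K4 * c"
        by (simp add: Y c K4_def)
      have "(level m - \<delta>) * real N - (K1 + real n * P.max_surprisal n) / real (n + \<tau>)
          = ((real (n + \<tau>) * (level m - \<delta>) + k n) * real N - K1 - real n * P.max_surprisal n - real N * k n) / real (n + \<tau>)"
        using n(1) by (simp add: field_simps)
      also have "\<dots> \<le> (window_sum P n ?Y - real N * k n) / real (n + \<tau>)"
        using elim(3) P.birkhoff_sum_le_window_sum[of n N y] by (intro divide_right_mono) auto
      finally have "(c - 1) * ((1 - \<epsilon>) * ln (real N)) + (level m - \<delta>) * real N
          \<le> 2 * ((level m + \<delta>) * real N) + 2 * \<delta> * real N + K4 * c + K5"
        using main elim(4) by (simp add: K5_def)
      \<comment> \<open>One of the two levels on the right cancels against the window term on the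
        left; the other is bounded here. The errors \<delta>, 2\<delta>, 2\<delta> and this last
        \<delta> make up 6\<delta>.\<close>
      moreover have "level m * real N \<le> (\<mu> + \<delta>) * real N"
        using level_le[OF m(1)] by (intro mult_right_mono) auto
      ultimately have "c * ((1 - \<epsilon>) * ln (real N) - K4) \<le> (\<mu> + 6 * \<delta>) * real N + K5 + (1 - \<epsilon>) * ln (real N)"
        by (simp add: algebra_simps)
      then show ?case
        using elim(2) by (simp add: up_def pos_le_divide_eq c_def)
    qed
    \<comment> \<open>This keeps N - c positive, so the infinite value of the estimator cannot
      occur.\<close>
    moreover have "\<forall>\<^sub>F N in sequentially. up N / real N < 1"
    proof -
      have "((\<lambda>N. up N / real N) \<longlongrightarrow> 0) sequentially" unfolding up_def using \<epsilon> \<delta> z by real_asymp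
      then show ?thesis by (rule order_tendstoD) simp
    qed
    moreover have "\<forall>\<^sub>F N in sequentially. up N * ln (real N) / (real N - up N) < z"
    proof -
      have "((\<lambda>N. up N * ln (real N) / (real N - up N)) \<longlongrightarrow> (\<mu> + 6 * \<delta>) * inverse (1 - \<epsilon>)) sequentially"
        unfolding up_def using \<epsilon> \<delta> z by real_asymp
      then show ?thesis using rate[unfolded divide_inverse] by (rule order_tendstoD)
    qed
    ultimately have "\<forall>\<^sub>F N in sequentially. mZM_estimator N y x \<le> ereal z"
      using eventually_gt_at_top[of 1]
    proof eventually_elim
      case (elim N)
      define c where "c = mZM_count N y x"
      have up: "real c \<le> up N" "up N < real N" using elim by (auto simp: c_def)
      then have "c \<noteq> N" by auto
      have "real c * ln (real N) / (real N - real c) \<le> up N * ln (real N) / (real N - up N)"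
        using up elim(4) by (intro frac_le mult_right_mono) auto
      also have "\<dots> \<le> z" using elim(3) by simp
      finally show ?case using \<open>c \<noteq> N\<close> by (simp add: mZM_estimator_def c_def)
    qed
    then show "limsup (\<lambda>N. mZM_estimator N (snd w) (fst w)) \<le> ereal z"
      unfolding x_def y_def by (rule Limsup_bounded)
  qed
qed

end

section \<open>One-sided derivatives of the pressure\<close>

context cross_pair
begin

text \<open>Lyapunov's inequality. Dividing by the mean \<open>A \<alpha>\<close> normalises the
  exponential to mean 1, so that the linear term of the chord inequality for \<open>exp\<close>
  integrates to zero.\<close>

lemma expectation_exp_scale_le:
  assumes s: "0 \<le> s" "s \<le> 1"
  shows "ln (\<integral>y. exp (s * \<alpha> * surprisal P (stake n y)) \<partial>Q)
    \<le> s * ln (\<integral>y. exp (\<alpha> * surprisal P (stake n y)) \<partial>Q)"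
proof -
  define A where "A \<beta> = (\<integral>y. exp (\<beta> * surprisal P (stake n y)) \<partial>Q)" for \<beta>
  have A: "0 < A \<beta>" for \<beta>
    using cross_entropic_sum_pos[of n \<beta>] by (simp add: A_def cross_entropic_sum_eq_expectation)
  have int: "integrable Q (\<lambda>y. exp (\<beta> * surprisal P (stake n y)))" for \<beta>
    by (rule Q.integrable_stake[of "\<lambda>a. exp (\<beta> * surprisal P a)"])
  have conv: "exp (s * v) \<le> 1 + s * (exp v - 1)" for v :: real
    using convex_onD[OF convex_on_exp[of 1], of s 0 v] s by (simp add: algebra_simps)
  have "A (s * \<alpha>) \<le> (\<integral>y. exp (s * ln (A \<alpha>)) * (1 + s * (exp (\<alpha> * surprisal P (stake n y)) / A \<alpha> - 1)) \<partial>Q)"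
    unfolding A_def[of "s * \<alpha>"]
  proof (rule integral_mono, goal_cases)
    case 1
    show ?case by (rule int)
  next
    case 2
    show ?case
      by (rule Q.integrable_stake[of "\<lambda>a. exp (s * ln (A \<alpha>)) * (1 + s * (exp (\<alpha> * surprisal P a) / A \<alpha> - 1))"])
  next
    case (3 y)
    let ?v = "\<alpha> * surprisal P (stake n y) - ln (A \<alpha>)"
    have "exp (s * \<alpha> * surprisal P (stake n y)) = exp (s * ln (A \<alpha>)) * exp (s * ?v)"
      by (simp add: algebra_simps flip: exp_add)
    also have "\<dots> \<le> exp (s * ln (A \<alpha>)) * (1 + s * (exp ?v - 1))"
      by (intro mult_left_mono conv) auto
    also have "exp ?v = exp (\<alpha> * surprisal P (stake n y)) / A \<alpha>"
      using A by (simp add: exp_diff)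
    finally show ?case .
  qed
  also have "\<dots> = exp (s * ln (A \<alpha>)) * (1 + s * ((\<integral>y. exp (\<alpha> * surprisal P (stake n y)) \<partial>Q) / A \<alpha> - 1))"
    using int[of \<alpha>] Q.prob_space by simp
  also have "\<dots> = exp (s * ln (A \<alpha>)) * (1 + s * (A \<alpha> / A \<alpha> - 1))"
    by (simp only: A_def)
  also have "\<dots> = exp (s * ln (A \<alpha>))" using A[of \<alpha>] by simp
  finally have "ln (A (s * \<alpha>)) \<le> s * ln (A \<alpha>)" using A by (simp add: ln_le_cancel_iff[symmetric] del: ln_le_cancel_iff)
  then show ?thesis by (simp add: A_def mult.assoc)
qed

lemma pressure_scale_le:
  assumes "0 \<le> s" "s \<le> 1"
  shows "cross_entropic_pressure P Q (s * \<alpha>) \<le> ereal s * cross_entropic_pressure P Q \<alpha>"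
proof -
  have "cross_entropic_pressure P Q (s * \<alpha>)
      \<le> limsup (\<lambda>n. ereal s * ereal (ln (\<integral>y. exp (\<alpha> * surprisal P (stake n y)) \<partial>Q) / real n))"
    unfolding cross_entropic_pressure_eq
  proof (intro Limsup_mono always_eventually allI)
    fix n
    have "ln (\<integral>y. exp (s * \<alpha> * surprisal P (stake n y)) \<partial>Q) / real n
        \<le> s * ln (\<integral>y. exp (\<alpha> * surprisal P (stake n y)) \<partial>Q) / real n"
      by (intro divide_right_mono expectation_exp_scale_le assms) auto
    then show "ereal (ln (\<integral>y. exp (s * \<alpha> * surprisal P (stake n y)) \<partial>Q) / real n)
        \<le> ereal s * ereal (ln (\<integral>y. exp (\<alpha> * surprisal P (stake n y)) \<partial>Q) / real n)"
      by simp
  qed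
  also have "\<dots> = ereal s * cross_entropic_pressure P Q \<alpha>"
    unfolding cross_entropic_pressure_eq using assms(1) by (rule limsup_ereal_mult_left)
  finally show ?thesis .
qed

text \<open>Of the convexity of the pressure only scaling towards 0, where it vanishes, is needed.
  This form also covers infinite values.\<close>

lemma pressure_quotient_mono:
  assumes "0 < a \<and> a \<le> b \<or> a \<le> b \<and> b < 0"
  shows "cross_entropic_pressure P Q a / ereal a \<le> cross_entropic_pressure P Q b / ereal b"
  using assms
proof
  assume ab: "0 < a \<and> a \<le> b"
  then have "cross_entropic_pressure P Q a \<le> ereal (a / b) * cross_entropic_pressure P Q b"
    using pressure_scale_le[of "a / b" b] by simp
  then show ?thesis
    using ab by (cases "cross_entropic_pressure P Q a"; cases "cross_entropic_pressure P Q b")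
      (auto simp: field_simps)
next
  assume ab: "a \<le> b \<and> b < 0"
  then have "cross_entropic_pressure P Q b \<le> ereal (b / a) * cross_entropic_pressure P Q a"
    using pressure_scale_le[of "b / a" a] by (simp add: divide_le_eq zero_le_divide_iff)
  then show ?thesis
    using ab by (cases "cross_entropic_pressure P Q a"; cases "cross_entropic_pressure P Q b")
      (auto simp: field_simps zero_less_divide_iff split: if_splits)
qed

text \<open>Writing the limit of the monotone quotients as a supremum lets a single negative
  \<alpha> realise any rate below the derivative.\<close>

lemma left_deriv_0_eq:
  "left_deriv_0 (cross_entropic_pressure P Q)
    = (SUP \<alpha>\<in>{..<0}. cross_entropic_pressure P Q \<alpha> / ereal \<alpha>)"
proof -
  have "((\<lambda>\<alpha>. cross_entropic_pressure P Q \<alpha> / ereal \<alpha>) \<longlongrightarrow>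
      (SUP \<alpha>\<in>{..<0} \<inter> UNIV. cross_entropic_pressure P Q \<alpha> / ereal \<alpha>)) (at 0 within ({..<0} \<inter> UNIV))"
    by (rule Lim_left_bound[where K = \<infinity>]) (auto intro!: pressure_quotient_mono)
  then show ?thesis
    unfolding left_deriv_0_def by (intro tendsto_Lim) auto
qed

lemma right_deriv_0_eq:
  "right_deriv_0 (cross_entropic_pressure P Q)
    = (INF \<alpha>\<in>{0<..}. cross_entropic_pressure P Q \<alpha> / ereal \<alpha>)"
proof -
  have "((\<lambda>\<alpha>. cross_entropic_pressure P Q \<alpha> / ereal \<alpha>) \<longlongrightarrow>
      (INF \<alpha>\<in>{0<..} \<inter> UNIV. cross_entropic_pressure P Q \<alpha> / ereal \<alpha>)) (at 0 within ({0<..} \<inter> UNIV))"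
    by (rule Lim_right_bound[where K = "-\<infinity>"]) (auto intro!: pressure_quotient_mono)
  then show ?thesis
    unfolding right_deriv_0_def by (intro tendsto_Lim) auto
qed

lemma right_deriv_0_nonneg: "0 \<le> right_deriv_0 (cross_entropic_pressure P Q)"
  unfolding right_deriv_0_eq
proof (rule INF_greatest)
  fix \<alpha> :: real assume \<alpha>: "\<alpha> \<in> {0<..}"
  have "0 \<le> ln (\<integral>y. exp (\<alpha> * surprisal P (stake n y)) \<partial>Q) / real n" for n
  proof -
    have "(1::real) = (\<integral>y. 1 \<partial>Q)" using Q.prob_space by simp
    also have "\<dots> \<le> (\<integral>y. exp (\<alpha> * surprisal P (stake n y)) \<partial>Q)"
      using \<alpha> Q.integrable_stake[of "\<lambda>a. exp (\<alpha> * surprisal P a)"] by (intro integral_mono) auto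
    finally show ?thesis by simp
  qed
  then have "0 \<le> cross_entropic_pressure P Q \<alpha>"
    unfolding cross_entropic_pressure_eq by (intro le_Limsup always_eventually) auto
  then show "0 \<le> cross_entropic_pressure P Q \<alpha> / ereal \<alpha>"
    using \<alpha> by (cases "cross_entropic_pressure P Q \<alpha>") auto
qed

text \<open>Rational levels below the derivative need only countably many null sets, and nonpositive
  levels are covered by the nonnegativity of the estimator.\<close>

lemma AE_left_deriv_0_le:
  "AE w in P \<Otimes>\<^sub>M Q. left_deriv_0 (cross_entropic_pressure P Q) \<le> liminf (\<lambda>N. mZM_estimator N (snd w) (fst w))"
proof -
  let ?D = "left_deriv_0 (cross_entropic_pressure P Q)"
  have "AE w in P \<Otimes>\<^sub>M Q. ereal (real_of_rat r) \<le> liminf (\<lambda>N. mZM_estimator N (snd w) (fst w))"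
    if r: "0 < real_of_rat r" "ereal (real_of_rat r) < ?D" for r
  proof -
    obtain \<mu> where \<mu>: "ereal (real_of_rat r) < ereal \<mu>" "ereal \<mu> < ?D"
      using ereal_dense2[OF r(2)] by blast
    then obtain \<alpha> where \<alpha>: "\<alpha> < 0" "ereal \<mu> < cross_entropic_pressure P Q \<alpha> / ereal \<alpha>"
      unfolding left_deriv_0_eq by (auto simp: less_SUP_iff)
    then have "cross_entropic_pressure P Q \<alpha> < ereal (\<alpha> * \<mu>)"
      by (cases "cross_entropic_pressure P Q \<alpha>") (auto simp: field_simps split: if_splits)
    from pressure_lessD[OF this] show ?thesis
      by (intro AE_liminf_estimator_ge[of "- \<alpha>" _ \<mu>]) (use \<alpha>(1) r(1) \<mu>(1) in simp_all)
  qed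
  then have "AE w in P \<Otimes>\<^sub>M Q. \<forall>r. 0 < real_of_rat r \<and> ereal (real_of_rat r) < ?D \<longrightarrow>
      ereal (real_of_rat r) \<le> liminf (\<lambda>N. mZM_estimator N (snd w) (fst w))"
    by (subst AE_all_countable) auto
  then show ?thesis
  proof eventually_elim
    case (elim w)
    show ?case
    proof (rule ccontr)
      assume "\<not> ?D \<le> liminf (\<lambda>N. mZM_estimator N (snd w) (fst w))"
      then have "liminf (\<lambda>N. mZM_estimator N (snd w) (fst w)) < ?D" by (simp only: not_le)
      from ereal_dense3[OF this] obtain r :: rat
        where r: "liminf (\<lambda>N. mZM_estimator N (snd w) (fst w)) < real_of_rat r" "real_of_rat r < ?D"
        by (elim exE conjE)
      have "0 \<le> liminf (\<lambda>N. mZM_estimator N (snd w) (fst w))"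
        by (rule Liminf_bounded) (simp add: mZM_estimator_nonneg)
      then have "0 < ereal (real_of_rat r)" using r(1) by (rule le_less_trans)
      then have "ereal (real_of_rat r) \<le> liminf (\<lambda>N. mZM_estimator N (snd w) (fst w))"
        using spec[OF elim, of r] r(2) by simp
      from leD[OF this] r(1) show False by (rule notE)
    qed
  qed
qed

end

lemma (in estimator_setting) AE_le_right_deriv_0:
  "AE w in P \<Otimes>\<^sub>M Q. limsup (\<lambda>N. mZM_estimator N (snd w) (fst w)) \<le> right_deriv_0 (cross_entropic_pressure P Q)"
proof -
  let ?D = "right_deriv_0 (cross_entropic_pressure P Q)"
  have "AE w in P \<Otimes>\<^sub>M Q. limsup (\<lambda>N. mZM_estimator N (snd w) (fst w)) \<le> ereal (real_of_rat r)"
    if r: "?D < ereal (real_of_rat r)" for r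
  proof -
    obtain \<mu> where \<mu>: "?D < ereal \<mu>" "ereal \<mu> < ereal (real_of_rat r)"
      using ereal_dense2[OF r] by blast
    \<comment> \<open>\<open>AE_limsup_estimator_le\<close> requires a positive rate; surprisals are
      nonnegative, so every level above the right derivative is positive.\<close>
    have "0 < ereal \<mu>" using right_deriv_0_nonneg \<mu>(1) by (rule le_less_trans)
    obtain \<alpha> where \<alpha>: "0 < \<alpha>" "cross_entropic_pressure P Q \<alpha> / ereal \<alpha> < ereal \<mu>"
      using \<mu>(1) unfolding right_deriv_0_eq by (auto simp: INF_less_iff)
    then have "cross_entropic_pressure P Q \<alpha> < ereal (\<alpha> * \<mu>)"
      by (cases "cross_entropic_pressure P Q \<alpha>") (auto simp: field_simps split: if_splits)
    from pressure_lessD[OF this] show ?thesis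
      by (intro AE_limsup_estimator_le[of \<alpha> \<mu>]) (use \<alpha>(1) \<mu>(2) \<open>0 < ereal \<mu>\<close> in simp_all)
  qed
  then have "AE w in P \<Otimes>\<^sub>M Q. \<forall>r. ?D < ereal (real_of_rat r) \<longrightarrow>
      limsup (\<lambda>N. mZM_estimator N (snd w) (fst w)) \<le> ereal (real_of_rat r)"
    by (subst AE_all_countable) auto
  then show ?thesis
  proof eventually_elim
    case (elim w)
    show ?case
    proof (rule ccontr)
      assume "\<not> limsup (\<lambda>N. mZM_estimator N (snd w) (fst w)) \<le> ?D"
      then have "?D < limsup (\<lambda>N. mZM_estimator N (snd w) (fst w))" by (simp only: not_le)
      from ereal_dense3[OF this] obtain r :: rat
        where r: "?D < real_of_rat r" "real_of_rat r < limsup (\<lambda>N. mZM_estimator N (snd w) (fst w))"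
        by (elim exE conjE)
      then have "limsup (\<lambda>N. mZM_estimator N (snd w) (fst w)) \<le> ereal (real_of_rat r)"
        using spec[OF elim, of r] by simp
      from leD[OF this] r(2) show False by (rule notE)
    qed
  qed
qed

theorem theorem2p6:
  fixes P Q :: "'a::finite stream measure"
  assumes "shift_invariant_prob P" and "shift_invariant_prob Q"
    and "selectively_lower_decoupled P" and "upper_decoupled P"
    and "upper_decoupled Q"
    and "nondegenerate P Q"
    and "supp Q \<subseteq> supp P"
  shows "AE (x, y) in P \<Otimes>\<^sub>M Q.
           left_deriv_0 (cross_entropic_pressure P Q) \<le> liminf (\<lambda>N. mZM_estimator N y x) \<and>
           liminf (\<lambda>N. mZM_estimator N y x) \<le> limsup (\<lambda>N. mZM_estimator N y x) \<and>
           limsup (\<lambda>N. mZM_estimator N y x) \<le> right_deriv_0 (cross_entropic_pressure P Q)"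
proof -
  obtain k \<tau> where k: "\<And>n. 0 \<le> k n" "k \<in> o(\<lambda>n. real n)"
      "\<forall>n\<ge>1. \<forall>m\<ge>1. \<forall>a\<in>supp_words P n. \<forall>\<xi>\<in>supp_words P \<tau>. \<forall>b\<in>supp_words P m.
         word_prob P (a @ \<xi> @ b) \<le> exp (k n) * word_prob P a * word_prob P b"
    using assms(4) unfolding upper_decoupled_def by blast
  obtain \<kappa> \<sigma> where \<kappa>: "\<And>n. 0 \<le> \<kappa> n" "\<kappa> \<in> o(\<lambda>n. real n)"
      "\<forall>n\<ge>1. \<forall>m\<ge>1. \<forall>a\<in>supp_words P n. \<forall>b\<in>supp_words P m.
         \<exists>l\<le>\<sigma>. \<exists>\<xi>\<in>supp_words P l. exp (- \<kappa> n) * word_prob P a * word_prob P b \<le> word_prob P (a @ \<xi> @ b)"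
    using assms(3) unfolding selectively_lower_decoupled_def by blast
  interpret estimator_setting P Q k \<tau> \<kappa> \<sigma>
    by unfold_locales (use assms k \<kappa> in auto)
  show ?thesis
    using AE_left_deriv_0_le AE_le_right_deriv_0
  proof eventually_elim
    case (elim w)
    then show ?case by (cases w) (simp add: Liminf_le_Limsup)
  qed
qed

end
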